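(* For $n\ge1$ let $\Phi^+(A_n)$ be the root poset of type $A_n$. Then \[\sum_{n\ge1}|\mathbf{E}(J(\Phi^+(A_n)))|\,z^n=\frac{-1-2z+\sqrt{z^2-4z+2-2\sqrt{1-4z+4z^2-4z^3}}}{2z}.\] Consequently, $|\mathbf{E}(J(\Phi^+(A_n)))|\sim\frac{\gamma}{\sqrt\pi}n^{-3/2}\rho^{n+1}$, where \[\rho=\frac{6}{2-8(3\sqrt{57}-1)^{-1/3}+(3\sqrt{57}-1)^{1/3}}\approx3.13040\] and \[\gamma=\frac{1}{4\sqrt{291}}\sqrt{576+(1726130304-69393024\sqrt{57})^{1/3}+12(998918+40158\sqrt{57})^{1/3}}\approx0.79594.\]
   Context: $\Phi^+(A_n)$ is isomorphic to the skew shape $\rho_{n\times n}\setminus\delta_{n-1}$, where $\rho_{n\times n}$ is the $n\times n$ square Young diagram, $\delta_{n-1}=(n-1,n-2,\dots,1)$, and the boxes are ordered by $\Box\le\Box'$ iff $\Box$ lies weakly northwest of $\Box'$ (English convention). $J(Q)$ is the lattice of order ideals of $Q$ ordered by containment. For a finite lattice $L$ and $x\in L$, an Ungar move sends $x$ to $\bigwedge(\{x\}\cup T)$ with $T$ a subset of the elements covered by $x$; it is nontrivial if $T\neq\emptyset$. Recursively, $\hat0$ is an Eeta win in $L$, and $x$ is an Eeta win iff no element obtainable from $x$ by a nontrivial Ungar move is an Eeta win (equivalently, in the game on $[\hat0,x]$ starting at $x$ where Atniss then Eeta alternately make nontrivial Ungar moves and the player unable to move loses, Eeta has a winning strategy).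 $\mathbf{E}(L)$ is the set of Eeta wins in $L$.
   Formalization: The printed generating function has a pole at z=0 and so cannot equal the sum; the outer square root is divided by z, giving (-1-2z+(1/z)sqrt(z^2-4z+2-2sqrt(1-4z+4z^2-4z^3)))/(2z). The asymptotics and constants are unchanged. *)

theory Defs
  imports
    Complex_Main
    "HOL-Algebra.Lattice"
    "HOL-Library.Landau_Symbols"
    "HOL-Computational_Algebra.Formal_Power_Series"
begin

unbundle asymp_equiv_syntax

section \<open>Ungar games on finite lattices\<close>

definition covered_elements :: "'a gorder \<Rightarrow> 'a \<Rightarrow> 'a set" where
  "covered_elements L x =
     {y \<in> carrier L. y \<sqsubset>\<^bsub>L\<^esub> x \<and> \<not> (\<exists>z\<in>carrier L. y \<sqsubset>\<^bsub>L\<^esub> z \<and> z \<sqsubset>\<^bsub>L\<^esub> x)}"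

definition nontrivial_Ungar_moves :: "'a gorder \<Rightarrow> 'a \<Rightarrow> 'a set" where
  "nontrivial_Ungar_moves L x =
     {\<Sqinter>\<^bsub>L\<^esub> (insert x T) | T. T \<subseteq> covered_elements L x \<and> T \<noteq> {}}"

lemma nontrivial_Ungar_moveD:
  assumes L: "lattice L" and fin: "finite (carrier L)" and x: "x \<in> carrier L"
    and y: "y \<in> nontrivial_Ungar_moves L x"
  shows "y \<in> carrier L" "y \<sqsubseteq>\<^bsub>L\<^esub> x" "y \<noteq> x"
proof -
  interpret lattice L by (fact L)
  from y obtain T where T: "T \<subseteq> covered_elements L x" "T \<noteq> {}" "y = \<Sqinter>\<^bsub>L\<^esub> (insert x T)"
    by (auto simp: nontrivial_Ungar_moves_def)
  from T(1) have TL: "insert x T \<subseteq> carrier L"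
    using x by (auto simp: covered_elements_def)
  have "greatest L y (Lower L (insert x T))"
    unfolding T(3) using TL fin by (intro finite_inf_greatest) (auto intro: finite_subset)
  with TL show yL: "y \<in> carrier L" and yx: "y \<sqsubseteq>\<^bsub>L\<^esub> x"
    by (auto intro: greatest_Lower_below)
  from T obtain t where t: "t \<in> T" by blast
  with TL have tL: "t \<in> carrier L" by auto
  have yt: "y \<sqsubseteq>\<^bsub>L\<^esub> t"
    using greatest_Lower_below[OF \<open>greatest L y _\<close>] t TL by blast
  have tx: "t \<sqsubseteq>\<^bsub>L\<^esub> x" "t \<noteq> x"
    using t T(1) by (auto simp: covered_elements_def lless_eq)
  show "y \<noteq> x"
    using yt tx tL x le_antisym by blast
qed

text \<open>
  The recursion is well-founded only on finite lattices, hence the guard; the case of the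
  least element is subsumed, since it covers nothing.
\<close>

function Eeta_win :: "'a gorder \<Rightarrow> 'a \<Rightarrow> bool" where
  "Eeta_win L x \<longleftrightarrow>
     (if lattice L \<and> finite (carrier L) \<and> x \<in> carrier L
      then \<forall>y\<in>nontrivial_Ungar_moves L x. \<not> Eeta_win L y
      else False)"
  by pat_completeness auto
termination
proof (relation "measure (\<lambda>(L, x). card {z \<in> carrier L. z \<sqsubseteq>\<^bsub>L\<^esub> x})", goal_cases)
  case (2 L x y)
  then interpret lattice L by blast
  from 2 have fin: "finite (carrier L)" and x: "x \<in> carrier L" by auto
  have y: "y \<in> carrier L" "y \<sqsubseteq>\<^bsub>L\<^esub> x" "y \<noteq> x"
    using 2 nontrivial_Ungar_moveD[of L x y] by auto
  have "{z \<in> carrier L. z \<sqsubseteq>\<^bsub>L\<^esub> y} \<subset> {z \<in> carrier L. z \<sqsubseteq>\<^bsub>L\<^esub> x}"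
  proof
    show "{z \<in> carrier L. z \<sqsubseteq>\<^bsub>L\<^esub> y} \<subseteq> {z \<in> carrier L. z \<sqsubseteq>\<^bsub>L\<^esub> x}"
      using y x le_trans by blast
    show "{z \<in> carrier L. z \<sqsubseteq>\<^bsub>L\<^esub> y} \<noteq> {z \<in> carrier L. z \<sqsubseteq>\<^bsub>L\<^esub> x}"
      using y x le_antisym le_refl by blast
  qed
  then show ?case
    using fin by (auto intro!: psubset_card_mono)
qed auto

declare Eeta_win.simps [simp del]

definition Eeta_wins :: "'a gorder \<Rightarrow> 'a set" where
  "Eeta_wins L = {x \<in> carrier L. Eeta_win L x}"

section \<open>Lattices of order ideals\<close>

definition order_ideals :: "'a gorder \<Rightarrow> 'a set gorder" where
  "order_ideals P =
     \<lparr>carrier = {I. I \<subseteq> carrier P \<and> (\<forall>x\<in>I. \<forall>y\<in>carrier P. y \<sqsubseteq>\<^bsub>P\<^esub> x \<longrightarrow> y \<in> I)},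
      eq = (=), le = (\<subseteq>)\<rparr>"

lemma lattice_order_ideals: "lattice (order_ideals P)"
proof
  fix I J assume IJ: "I \<in> carrier (order_ideals P)" "J \<in> carrier (order_ideals P)"
  have "least (order_ideals P) (I \<union> J) (Upper (order_ideals P) {I, J})"
    using IJ by (auto simp: order_ideals_def least_def Upper_def)
  then show "\<exists>K. least (order_ideals P) K (Upper (order_ideals P) {I, J})" ..
  have "greatest (order_ideals P) (I \<inter> J) (Lower (order_ideals P) {I, J})"
    using IJ by (auto simp: order_ideals_def greatest_def Lower_def)
  then show "\<exists>K. greatest (order_ideals P) K (Lower (order_ideals P) {I, J})" ..
qed (auto simp: order_ideals_def)

lemma finite_order_ideals: "finite (carrier P) \<Longrightarrow> finite (carrier (order_ideals P))"
  by (rule finite_subset[of _ "Pow (carrier P)"]) (auto simp: order_ideals_def)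

section \<open>The root poset of type $A_n$\<close>

text \<open>
  \<open>A_root i j\<close> is $e_i - e_j$; vectors of $\mathbb{Z}^{n+1}$ are functions supported on
  \<open>{1..n+1}\<close>, and the simple roots are \<open>A_root k (k + 1)\<close> for \<open>k \<in> {1..n}\<close>.
\<close>

definition A_root :: "nat \<Rightarrow> nat \<Rightarrow> nat \<Rightarrow> int" where
  "A_root i j = (\<lambda>k. (if k = i then 1 else 0) - (if k = j then 1 else 0))"

definition A_root_poset :: "nat \<Rightarrow> (nat \<Rightarrow> int) gorder" where
  "A_root_poset n =
     \<lparr>carrier = {A_root i j | i j. 1 \<le> i \<and> i < j \<and> j \<le> n + 1},
      eq = (=),
      le = (\<lambda>\<alpha> \<beta>. \<exists>c :: nat \<Rightarrow> nat. \<forall>m. \<beta> m - \<alpha> m = (\<Sum>k=1..n. int (c k) * A_root k (k + 1) m))\<rparr>"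

lemma sum_A_root:
  assumes "1 \<le> i" "i < j"
  shows "(\<Sum>m\<le>k. A_root i j m) = (if i \<le> k \<and> k < j then 1 else 0)"
  using assms by (simp add: A_root_def sum_subtractf)

lemma A_root_poset_le_iff:
  assumes ij: "1 \<le> i" "i < j" "j \<le> n + 1" and ij': "1 \<le> i'" "i' < j'" "j' \<le> n + 1"
  shows "A_root i j \<sqsubseteq>\<^bsub>A_root_poset n\<^esub> A_root i' j' \<longleftrightarrow> i' \<le> i \<and> j \<le> j'"
proof
  assume "A_root i j \<sqsubseteq>\<^bsub>A_root_poset n\<^esub> A_root i' j'"
  then obtain c :: "nat \<Rightarrow> nat" where
    c: "A_root i' j' m - A_root i j m = (\<Sum>k=1..n. int (c k) * A_root k (k + 1) m)" for m
    by (auto simp: A_root_poset_def)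
  have nonneg: "(\<Sum>m\<le>l. A_root i' j' m) - (\<Sum>m\<le>l. A_root i j m) \<ge> 0" for l
  proof -
    have "(\<Sum>m\<le>l. A_root i' j' m) - (\<Sum>m\<le>l. A_root i j m)
        = (\<Sum>m\<le>l. \<Sum>k=1..n. int (c k) * A_root k (k + 1) m)"
      by (simp only: c sum_subtractf[symmetric])
    also have "\<dots> = (\<Sum>k=1..n. int (c k) * (\<Sum>m\<le>l. A_root k (k + 1) m))"
      by (subst sum.swap) (simp only: sum_distrib_left)
    also have "\<dots> \<ge> 0"
    proof (rule sum_nonneg)
      fix k assume "k \<in> {1..n}"
      then show "0 \<le> int (c k) * (\<Sum>m\<le>l. A_root k (k + 1) m)"
        by (subst sum_A_root) auto
    qed
    finally show ?thesis .
  qed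
  have "(if i' \<le> l \<and> l < j' then 1 else 0) - (if i \<le> l \<and> l < j then 1 else 0) \<ge> (0 :: int)" for l
    using nonneg[of l] by (simp only: sum_A_root[OF ij(1,2)] sum_A_root[OF ij'(1,2)])
  from this[of i] this[of "j - 1"] show "i' \<le> i \<and> j \<le> j'"
    using ij ij' by (auto split: if_splits)
next
  have tele: "(\<Sum>k=a..<b. A_root k (k + 1) m) = A_root a b m" if "a \<le> b" for a b m
    using that
  proof (induction b rule: dec_induct)
    case (step b)
    then show ?case by (simp add: A_root_def)
  qed (simp add: A_root_def)
  assume le: "i' \<le> i \<and> j \<le> j'"
  define c :: "nat \<Rightarrow> nat" where "c = (\<lambda>k. if k \<in> {i'..<i} \<union> {j..<j'} then 1 else 0)"
  have "A_root i' j' m - A_root i j m = (\<Sum>k=1..n. int (c k) * A_root k (k + 1) m)" for m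
  proof -
    have "(\<Sum>k=1..n. int (c k) * A_root k (k + 1) m)
        = (\<Sum>k\<in>{i'..<i} \<union> {j..<j'}. A_root k (k + 1) m)"
      using ij ij' le by (intro sum.mono_neutral_cong_right) (auto simp: c_def)
    also have "\<dots> = A_root i' i m + A_root j j' m"
      using ij ij' le by (subst sum.union_disjoint) (auto simp: tele[simplified])
    also have "\<dots> = A_root i' j' m - A_root i j m"
      by (simp add: A_root_def)
    finally show ?thesis by simp
  qed
  then show "A_root i j \<sqsubseteq>\<^bsub>A_root_poset n\<^esub> A_root i' j'"
    by (auto simp: A_root_poset_def)
qed

lemma finite_A_root_poset: "finite (carrier (A_root_poset n))"
proof (rule finite_subset)
  show "carrier (A_root_poset n) \<subseteq> (\<lambda>(i, j). A_root i j) ` ({..n + 1} \<times> {..n + 1})"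
    by (auto simp: A_root_poset_def)
qed auto

text \<open>
  The skew shape obtained from the $n \times n$ square by removing the staircase
  $(n-1, n-2, \dots, 1)$; boxes are pairs (row, column) and row \<open>r\<close> of the staircase has
  \<open>n - r\<close> boxes.
\<close>

definition A_skew_shape :: "nat \<Rightarrow> (nat \<times> nat) gorder" where
  "A_skew_shape n =
     \<lparr>carrier = {(r, c). r \<in> {1..n} \<and> c \<in> {1..n} \<and> n - r < c},
      eq = (=),
      le = (\<lambda>(r, c) (r', c'). r \<le> r' \<and> c \<le> c')\<rparr>"

lemma A_skew_shape_iso:
  fixes n :: nat
  defines "f \<equiv> (\<lambda>(r, c). A_root (n + 1 - r) (c + 1))"
  shows "bij_betw f (carrier (A_skew_shape n)) (carrier (A_root_poset n))"
    and "x \<in> carrier (A_skew_shape n) \<Longrightarrow> y \<in> carrier (A_skew_shape n) \<Longrightarrow>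
           f x \<sqsubseteq>\<^bsub>A_root_poset n\<^esub> f y \<longleftrightarrow> x \<sqsubseteq>\<^bsub>A_skew_shape n\<^esub> y"
proof -
  show le: "f x \<sqsubseteq>\<^bsub>A_root_poset n\<^esub> f y \<longleftrightarrow> x \<sqsubseteq>\<^bsub>A_skew_shape n\<^esub> y"
    if "x \<in> carrier (A_skew_shape n)" "y \<in> carrier (A_skew_shape n)" for x y
  proof -
    obtain r c r' c' where xy: "x = (r, c)" "y = (r', c')"
      by (cases x, cases y)
    show ?thesis
      using that unfolding f_def xy prod.case
      by (subst A_root_poset_le_iff) (auto simp: A_skew_shape_def)
  qed
  have refl: "\<alpha> \<sqsubseteq>\<^bsub>A_root_poset n\<^esub> \<alpha>" for \<alpha>
    by (auto simp: A_root_poset_def intro: exI[of _ "\<lambda>_. 0"])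
  have "inj_on f (carrier (A_skew_shape n))"
  proof (rule inj_onI)
    fix x y assume xy: "x \<in> carrier (A_skew_shape n)" "y \<in> carrier (A_skew_shape n)" "f x = f y"
    then have "x \<sqsubseteq>\<^bsub>A_skew_shape n\<^esub> y" "y \<sqsubseteq>\<^bsub>A_skew_shape n\<^esub> x"
      using le[of x y] le[of y x] refl by auto
    then show "x = y" by (auto simp: A_skew_shape_def)
  qed
  moreover have "f ` carrier (A_skew_shape n) = carrier (A_root_poset n)"
  proof
    show "f ` carrier (A_skew_shape n) \<subseteq> carrier (A_root_poset n)"
      by (force simp: f_def A_skew_shape_def A_root_poset_def)
    show "carrier (A_root_poset n) \<subseteq> f ` carrier (A_skew_shape n)"
    proof
      fix \<alpha> assume "\<alpha> \<in> carrier (A_root_poset n)"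
      then obtain i j where ij: "\<alpha> = A_root i j" "1 \<le> i" "i < j" "j \<le> n + 1"
        by (auto simp: A_root_poset_def)
      then have "\<alpha> = f (n + 1 - i, j - 1)" "(n + 1 - i, j - 1) \<in> carrier (A_skew_shape n)"
        by (auto simp: f_def A_skew_shape_def)
      then show "\<alpha> \<in> f ` carrier (A_skew_shape n)" by blast
    qed
  qed
  ultimately show "bij_betw f (carrier (A_skew_shape n)) (carrier (A_root_poset n))"
    by (simp add: bij_betw_def)
qed

section \<open>Square roots of formal power series\<close>

text \<open>
  The branch with nonnegative leading coefficient, which is the one represented by the real
  square root for small positive arguments. The library's radicals of power series need a
  nonzero constant term, and so do not cover square roots such as \<open>fps_X + \<dots>\<close>.
\<close>

definition fps_sqrt :: "real fps \<Rightarrow> real fps" where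
  "fps_sqrt f = (THE g. g ^ 2 = f \<and> 0 \<le> fps_nth g (subdegree g))"

lemma fps_sqrt_unique:
  assumes "g ^ 2 = f" "0 \<le> fps_nth g (subdegree g)"
  shows "fps_sqrt f = g"
  unfolding fps_sqrt_def
proof (rule the_equality)
  fix h assume h: "h ^ 2 = f \<and> 0 \<le> fps_nth h (subdegree h)"
  with assms have "h = g \<or> h = - g"
    by (metis power2_eq_iff)
  then show "h = g"
  proof
    assume "h = - g"
    with h assms have "fps_nth g (subdegree g) = 0" by simp
    then show "h = g" using \<open>h = - g\<close> by simp
  qed
qed (use assms in auto)

lemma fps_sqrt_square:
  assumes "fps_nth g 0 > 0"
  shows "fps_sqrt (fps_X ^ (2 * k) * g) ^ 2 = fps_X ^ (2 * k) * g"
proof -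
  define s where "s = fps_radical (\<lambda>n x. root n x) 2 g"
  have s2: "s ^ 2 = g"
    using power_radical[of g "\<lambda>n x. root n x" 1] real_root_pow_pos2[of 2 "fps_nth g 0"] assms
    by (simp add: s_def numeral_2_eq_2)
  have s0: "fps_nth s 0 > 0"
    using assms by (simp add: s_def numeral_2_eq_2)
  have "subdegree (fps_X ^ k * s) = k"
    using s0 by (intro subdegreeI) (auto simp: fps_X_power_mult_nth)
  then have "0 \<le> fps_nth (fps_X ^ k * s) (subdegree (fps_X ^ k * s))"
    using s0 by (simp add: fps_X_power_mult_nth)
  moreover have "(fps_X ^ k * s) ^ 2 = fps_X ^ (2 * k) * g"
    by (simp add: power_mult_distrib s2 power_mult[symmetric] mult.commute)
  ultimately show ?thesis
    using fps_sqrt_unique by metis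
qed

end

theory Submission
  imports Defs "HOL-Analysis.Analysis" "HOL-Real_Asymp.Real_Asymp"
begin

text \<open>
  Order ideals of the root poset are Dyck words of length \<open>2 n + 2\<close>, and a nontrivial Ungar move
  lowers a nonempty set of peaks that are not at height one. The Eeta wins are the words accepted
  by a four-state automaton run on every piece between two returns to the axis: no move joins two
  accepted words, and every other Dyck word has a move to an accepted one. Cutting Dyck words at
  their last return gives an algebraic system for the accepted words, whose solution is the stated
  nested square root. The dominant singularity is the real zero of \<open>1 - 4 z + 4 z\<^sup>2 - 4 z\<^sup>3\<close>; after
  rationalising the outer root, the generating function is \<open>sqrt (1 - \<rho> z)\<close> times a series that
  converges beyond \<open>1 / \<rho>\<close>, plus another such series, and Tannery's theorem transfers the
  asymptotics of the binomial coefficients.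
\<close>

section \<open>Ungar moves in lattices of order ideals\<close>

text \<open>The accepted words are the kernel of the move graph: in a finite game without cycles, a
  set that no move joins internally and that every outside position reaches in one move consists of
  the losses for the player to move, that is, of the Eeta wins. Lowered peaks are disjoint factors
  UD, so both halves become inductions along one left-to-right scan.

  The analytic obstacle is that the singular inner root s sits inside the outer root. With a = 1 - 2
  X + X^2/2 the outer radicand is 2 a - 2 s, and a^2 - s^2 = X^2 (1 + 2 X + X^2/4) = (X m)^2 for a
  series m that is regular at the singularity. Hence the outer root is k - s/k with k^2 = a + X m,
  and s enters only linearly. That m, k and 1/k converge beyond 1/rho = 0.3194... is not derived
  from the location of complex zeros: weighted sums of absolute coefficients are bounded at the
  slightly larger radius 0.33.\<close>

definition maximal_in :: "'a gorder \<Rightarrow> 'a set \<Rightarrow> 'a set" where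
  "maximal_in P I = {x \<in> I. \<forall>y\<in>I. x \<sqsubseteq>\<^bsub>P\<^esub> y \<longrightarrow> y = x}"

lemma Diff_maximal_ideal:
  assumes "I \<in> carrier (order_ideals P)" "M \<subseteq> maximal_in P I"
  shows "I - M \<in> carrier (order_ideals P)"
  using assms unfolding order_ideals_def maximal_in_def by fastforce

lemma exists_maximal_in:
  assumes P: "partial_order P" and A: "finite A" "A \<noteq> {}" "A \<subseteq> carrier P"
  shows "\<exists>x. x \<in> maximal_in P A"
proof -
  interpret partial_order P by (fact P)
  show ?thesis
    using A
  proof (induction A rule: finite_ne_induct)
    case (singleton x)
    then show ?case by (auto simp: maximal_in_def)
  next
    case (insert x F)
    then obtain m where m: "m \<in> F" "\<forall>y\<in>F. m \<sqsubseteq>\<^bsub>P\<^esub> y \<longrightarrow> y = m"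
      by (auto simp: maximal_in_def)
    show ?case
    proof (cases "m \<sqsubseteq>\<^bsub>P\<^esub> x")
      case True
      have "y = x" if "y \<in> F" "x \<sqsubseteq>\<^bsub>P\<^esub> y" for y
      proof -
        have "m \<sqsubseteq>\<^bsub>P\<^esub> y" using le_trans[OF True that(2)] insert.prems m(1) that(1) by auto
        then have "y = m" using m that by blast
        then show ?thesis using le_antisym[OF that(2)] True insert.prems m(1) by auto
      qed
      then show ?thesis by (auto simp: maximal_in_def)
    next
      case False
      then show ?thesis using m by (auto simp: maximal_in_def)
    qed
  qed
qed

text \<open>If \<open>J\<close> is covered by \<open>I\<close>, let \<open>x\<close> be maximal in
  \<open>I - J\<close>. An element of \<open>J\<close> above \<open>x\<close> would pull
  \<open>x\<close> into \<open>J\<close>, so \<open>x\<close> is maximal in all of \<open>I\<close>;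
  then \<open>I - {x}\<close> is an ideal between \<open>J\<close> and \<open>I\<close> and must
  equal \<open>J\<close>.\<close>

lemma covered_elements_order_ideals:
  assumes P: "partial_order P" and fin: "finite (carrier P)"
    and I: "I \<in> carrier (order_ideals P)"
  shows "covered_elements (order_ideals P) I = (\<lambda>x. I - {x}) ` maximal_in P I"
proof -
  have ll: "J \<sqsubset>\<^bsub>order_ideals P\<^esub> K \<longleftrightarrow> J \<subset> K" for J K
    by (auto simp: lless_def order_ideals_def)
  have sub: "I \<subseteq> carrier P" using I by (auto simp: order_ideals_def)
  show ?thesis
  proof (intro equalityI subsetI)
    fix J assume "J \<in> covered_elements (order_ideals P) I"
    then have J: "J \<in> carrier (order_ideals P)" "J \<subset> I"
      and nb: "\<And>K. K \<in> carrier (order_ideals P) \<Longrightarrow> J \<subset> K \<Longrightarrow> K \<subset> I \<Longrightarrow> False"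
      by (auto simp: covered_elements_def ll)
    have "finite (I - J)" using sub fin finite_subset by blast
    then obtain x where x: "x \<in> maximal_in P (I - J)"
      using exists_maximal_in[OF P, of "I - J"] J sub by blast
    have xI: "x \<in> maximal_in P I"
      unfolding maximal_in_def
    proof (clarsimp, intro conjI ballI impI)
      show "x \<in> I" using x by (auto simp: maximal_in_def)
      fix y assume y: "y \<in> I" "x \<sqsubseteq>\<^bsub>P\<^esub> y"
      have "y \<notin> J"
        using y J x sub by (auto simp: order_ideals_def maximal_in_def)
      then show "y = x" using x y by (auto simp: maximal_in_def)
    qed
    have "I - {x} \<in> carrier (order_ideals P)"
      using Diff_maximal_ideal[OF I, of "{x}"] xI by auto
    moreover have "J \<subseteq> I - {x}" "I - {x} \<subset> I" using x J by (auto simp: maximal_in_def)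
    ultimately have "J = I - {x}" using nb by blast
    then show "J \<in> (\<lambda>x. I - {x}) ` maximal_in P I" using xI by blast
  next
    fix J assume "J \<in> (\<lambda>x. I - {x}) ` maximal_in P I"
    then obtain x where x: "x \<in> maximal_in P I" "J = I - {x}" by blast
    then have "J \<in> carrier (order_ideals P)" using Diff_maximal_ideal[OF I, of "{x}"] by auto
    with x show "J \<in> covered_elements (order_ideals P) I"
      by (auto simp: covered_elements_def ll maximal_in_def)
  qed
qed

lemma nontrivial_Ungar_moves_order_ideals:
  assumes P: "partial_order P" and fin: "finite (carrier P)"
    and I: "I \<in> carrier (order_ideals P)"
  shows "nontrivial_Ungar_moves (order_ideals P) I
    = {I - M | M. M \<subseteq> maximal_in P I \<and> M \<noteq> {}}"
proof -
  interpret L: lattice "order_ideals P" by (rule lattice_order_ideals)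
  have inf: "\<Sqinter>\<^bsub>order_ideals P\<^esub> (insert I ((\<lambda>x. I - {x}) ` M)) = I - M"
    if M: "M \<subseteq> maximal_in P I" for M
  proof -
    have each: "I - {x} \<in> carrier (order_ideals P)" if "x \<in> M" for x
      using Diff_maximal_ideal[OF I, of "{x}"] M that by auto
    have "greatest (order_ideals P) (I - M)
        (Lower (order_ideals P) (insert I ((\<lambda>x. I - {x}) ` M)))" (is "greatest _ _ ?Lo")
    proof (rule greatest_LowerI)
      show "I - M \<in> carrier (order_ideals P)" by (rule Diff_maximal_ideal[OF I M])
      show "insert I ((\<lambda>x. I - {x}) ` M) \<subseteq> carrier (order_ideals P)" using each I by auto
      fix y
      show "y \<in> insert I ((\<lambda>x. I - {x}) ` M) \<Longrightarrow> I - M \<sqsubseteq>\<^bsub>order_ideals P\<^esub> y"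
        by (auto simp: order_ideals_def)
      assume y: "y \<in> ?Lo"
      have "y \<subseteq> I" using y I by (auto simp: Lower_def order_ideals_def)
      moreover have "y \<subseteq> I - {x}" if "x \<in> M" for x
      proof -
        have "y \<sqsubseteq>\<^bsub>order_ideals P\<^esub> I - {x}"
          using y each[OF that] that unfolding Lower_def by blast
        then show ?thesis by (simp add: order_ideals_def)
      qed
      ultimately show "y \<sqsubseteq>\<^bsub>order_ideals P\<^esub> I - M"
        by (auto simp: order_ideals_def)
    qed
    then show ?thesis
      unfolding inf_def by (metis (mono_tags, lifting) L.greatest_unique someI)
  qed
  show ?thesis
    unfolding nontrivial_Ungar_moves_def covered_elements_order_ideals[OF assms]
  proof (intro equalityI subsetI)
    fix J assume "J \<in> {\<Sqinter>\<^bsub>order_ideals P\<^esub> insert I T |T. T \<subseteq> (\<lambda>x. I - {x}) ` maximal_in P I \<and> T \<noteq> {}}"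
    then obtain T where T: "J = \<Sqinter>\<^bsub>order_ideals P\<^esub> insert I T"
      "T \<subseteq> (\<lambda>x. I - {x}) ` maximal_in P I" "T \<noteq> {}" by blast
    then obtain M where M: "M \<subseteq> maximal_in P I" "T = (\<lambda>x. I - {x}) ` M"
      by (auto simp: subset_image_iff)
    then show "J \<in> {I - M |M. M \<subseteq> maximal_in P I \<and> M \<noteq> {}}"
      using T inf[OF M(1)] by auto
  next
    fix J assume "J \<in> {I - M |M. M \<subseteq> maximal_in P I \<and> M \<noteq> {}}"
    then obtain M where "J = I - M" "M \<subseteq> maximal_in P I" "M \<noteq> {}" by blast
    then show "J \<in> {\<Sqinter>\<^bsub>order_ideals P\<^esub> insert I T |T. T \<subseteq> (\<lambda>x. I - {x}) ` maximal_in P I \<and> T \<noteq> {}}"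
      using inf[of M] by (intro CollectI exI[of _ "(\<lambda>x. I - {x}) ` M"]) auto
  qed
qed

text \<open>Supplies the reverse of a one-element move: \<open>x\<close> is minimal in the
  complement, obtained as a maximal element for the dual order.\<close>

lemma exists_maximal_insert_ideal:
  assumes P: "partial_order P" and fin: "finite (carrier P)"
    and J: "J \<in> carrier (order_ideals P)" and ne: "J \<noteq> carrier P"
  shows "\<exists>x. x \<notin> J \<and> x \<in> carrier P \<and> insert x J \<in> carrier (order_ideals P)
    \<and> x \<in> maximal_in P (insert x J)"
proof -
  interpret partial_order P by (fact P)
  have sub: "J \<subseteq> carrier P" using J by (auto simp: order_ideals_def)
  interpret D: partial_order "inv_gorder P" by (rule dual_order)
  have "\<exists>x. x \<in> maximal_in (inv_gorder P) (carrier P - J)"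
    using sub ne fin by (intro exists_maximal_in D.partial_order_axioms) auto
  then obtain x where x: "x \<in> carrier P" "x \<notin> J" and
    min: "\<And>y. y \<in> carrier P \<Longrightarrow> y \<notin> J \<Longrightarrow> y \<sqsubseteq>\<^bsub>P\<^esub> x \<Longrightarrow> y = x"
    by (auto simp: maximal_in_def)
  have "insert x J \<in> carrier (order_ideals P)"
    using J x min by (auto simp: order_ideals_def)
  moreover have "x \<in> maximal_in P (insert x J)"
    using J x by (auto simp: order_ideals_def maximal_in_def)
  ultimately show ?thesis using x by blast
qed

lemma partial_order_A_root_poset: "partial_order (A_root_poset n)"
proof
  show "(.=\<^bsub>A_root_poset n\<^esub>) = (=)" by (simp add: A_root_poset_def)
next
  fix x y assume xy: "x \<sqsubseteq>\<^bsub>A_root_poset n\<^esub> y" "y \<sqsubseteq>\<^bsub>A_root_poset n\<^esub> x"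
    "x \<in> carrier (A_root_poset n)" "y \<in> carrier (A_root_poset n)"
  then obtain i j i' j' where ij: "x = A_root i j" "1 \<le> i" "i < j" "j \<le> n + 1"
    "y = A_root i' j'" "1 \<le> i'" "i' < j'" "j' \<le> n + 1"
    by (auto simp: A_root_poset_def)
  then have "i' \<le> i \<and> j \<le> j'" "i \<le> i' \<and> j' \<le> j"
    using xy A_root_poset_le_iff by metis+
  then show "x .=\<^bsub>A_root_poset n\<^esub> y" using ij by (auto simp: A_root_poset_def)
next
  fix x y z assume xyz: "x \<sqsubseteq>\<^bsub>A_root_poset n\<^esub> y" "y \<sqsubseteq>\<^bsub>A_root_poset n\<^esub> z"
    "x \<in> carrier (A_root_poset n)" "y \<in> carrier (A_root_poset n)" "z \<in> carrier (A_root_poset n)"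
  then obtain i j i' j' i'' j'' where ij: "x = A_root i j" "1 \<le> i" "i < j" "j \<le> n + 1"
    "y = A_root i' j'" "1 \<le> i'" "i' < j'" "j' \<le> n + 1"
    "z = A_root i'' j''" "1 \<le> i''" "i'' < j''" "j'' \<le> n + 1"
    by (auto simp: A_root_poset_def)
  then have "i' \<le> i \<and> j \<le> j'" "i'' \<le> i' \<and> j' \<le> j''"
    using xyz A_root_poset_le_iff by metis+
  then have "i'' \<le> i \<and> j \<le> j''" by simp
  then show "x \<sqsubseteq>\<^bsub>A_root_poset n\<^esub> z" using ij A_root_poset_le_iff by metis
qed (auto simp: A_root_poset_def intro: exI[of _ "\<lambda>_. 0"])

section \<open>Order ideals as Dyck words\<close>

text \<open>\<open>True\<close> is an up step, and \<open>h\<close> is the height at which the word starts.\<close>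

fun ups :: "bool list \<Rightarrow> nat \<Rightarrow> nat" where
  "ups [] k = 0"
| "ups (b # w) 0 = 0"
| "ups (b # w) (Suc k) = (if b then 1 else 0) + ups w k"

fun dyck :: "nat \<Rightarrow> bool list \<Rightarrow> bool" where
  "dyck h [] \<longleftrightarrow> h = 0"
| "dyck h (True # w) \<longleftrightarrow> dyck (Suc h) w"
| "dyck 0 (False # w) \<longleftrightarrow> False"
| "dyck (Suc h) (False # w) \<longleftrightarrow> dyck h w"

text \<open>Simultaneous lowering of any set of peaks, the empty set included. The inductive form
  follows the automaton letter by letter, while \<open>peaks\<close> matches the geometry of ideals;
  \<open>flips_ups\<close> and \<open>flips_exists\<close> link the two. The start height
  \<open>Suc h\<close> in \<open>Flip\<close> spares peaks that stand on the axis, to which no root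
  corresponds.\<close>

inductive flips :: "nat \<Rightarrow> bool list \<Rightarrow> bool list \<Rightarrow> bool" where
  Nil: "flips h [] []"
| Up: "flips (Suc h) w w' \<Longrightarrow> flips h (True # w) (True # w')"
| Down: "flips h w w' \<Longrightarrow> flips (Suc h) (False # w) (False # w')"
| Flip: "flips (Suc h) w w' \<Longrightarrow> flips (Suc h) (True # False # w) (False # True # w')"

text \<open>The last condition says that the height \<open>h + 2 * ups w j - j\<close> just before the peak is positive.\<close>

definition peaks :: "nat \<Rightarrow> bool list \<Rightarrow> nat set" where
  "peaks h w = {Suc j | j. Suc (Suc j) \<le> length w \<and> ups w (Suc j) = Suc (ups w j)
     \<and> ups w (Suc (Suc j)) = ups w (Suc j) \<and> Suc j \<le> h + 2 * ups w j}"

lemma ups_0 [simp]: "ups w 0 = 0"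
  by (cases w) auto

lemma ups_le: "ups w k \<le> k"
  by (induction w k rule: ups.induct) auto

lemma ups_mono: "j \<le> k \<Longrightarrow> ups w j \<le> ups w k"
proof (induction w k arbitrary: j rule: ups.induct)
  case (3 b w k)
  then show ?case by (cases j) auto
qed auto

lemma ups_Suc_cases: "ups w (Suc k) = ups w k \<or> ups w (Suc k) = Suc (ups w k)"
proof (induction w k rule: ups.induct)
  case (2 b w)
  then show ?case by simp
qed auto

lemma ups_add_le: "ups w (k + l) \<le> ups w k + l"
proof (induction l)
  case (Suc l)
  then show ?case using ups_Suc_cases[of w "k + l"] by auto
qed simp

lemma ups_inject:
  assumes "length w = length w'" "\<And>k. ups w k = ups w' k"
  shows "w = w'"
  using assms
proof (induction w w' rule: list_induct2)
  case (Cons b w b' w')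
  from Cons.prems[of 1] have "b = b'" by (auto split: if_splits)
  moreover have "ups w k = ups w' k" for k
    using Cons.prems[of "Suc k"] \<open>b = b'\<close> by simp
  ultimately show ?case using Cons.IH by simp
qed simp

lemma dyck_height: "dyck h w \<Longrightarrow> k \<le> length w \<Longrightarrow> k \<le> h + 2 * ups w k"
proof (induction h w arbitrary: k rule: dyck.induct)
  case (2 h w)
  then show ?case by (cases k) fastforce+
next
  case (4 h w)
  then show ?case by (cases k) fastforce+
qed auto

lemma dyck_ups_length: "dyck h w \<Longrightarrow> h + 2 * ups w (length w) = length w"
  by (induction h w rule: dyck.induct) auto

lemma ups_beyond: "length w \<le> k \<Longrightarrow> ups w k = ups w (length w)"
  by (induction w k rule: ups.induct) auto

lemma dyck_replicate: "dyck h (replicate m True @ replicate (m + h) False)"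
proof (induction m arbitrary: h)
  case 0
  have "dyck h (replicate h False)" by (induction h) auto
  then show ?case by simp
next
  case (Suc m)
  from Suc[of "Suc h"] show ?case by simp
qed

lemma ups_replicate: "ups (replicate m True @ replicate l False) k = min m k"
proof (induction m arbitrary: k)
  case 0
  have "ups (replicate l False) k = 0" for l
  proof (induction l arbitrary: k)
    case (Suc l)
    then show ?case by (cases k) auto
  qed simp
  then show ?case by simp
next
  case (Suc m)
  then show ?case by (cases k) auto
qed

section \<open>Left-to-right passes and sets of lowered peaks\<close>

lemma flips_length: "flips h w w' \<Longrightarrow> length w' = length w"
  by (induction rule: flips.induct) auto

lemma flips_dyck: "flips h w w' \<Longrightarrow> dyck h w \<Longrightarrow> dyck h w'"
  by (induction rule: flips.induct) auto

lemma peaks_Cons: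
  "Suc (Suc k) \<in> peaks h (True # w) \<longleftrightarrow> Suc k \<in> peaks (Suc h) w"
  "Suc (Suc k) \<in> peaks (Suc h) (False # w) \<longleftrightarrow> Suc k \<in> peaks h w"
  by (auto simp: peaks_def)

lemma zero_notin_peaks [simp]: "0 \<notin> peaks h w"
  by (auto simp: peaks_def)

text \<open>Replacing UD by DU alters only the prefix count at the peak itself, by one, so the
  prefix counts record exactly which peaks were lowered.\<close>

lemma flips_ups:
  assumes "flips h w w'"
  shows "\<exists>S\<subseteq>peaks h w. \<forall>k. ups w' k + (if k \<in> S then 1 else 0) = ups w k"
  using assms
proof (induction rule: flips.induct)
  case (Nil h)
  show ?case by (rule exI[of _ "{}"]) auto
next
  case (Up h w w')
  then obtain S where S: "S \<subseteq> peaks (Suc h) w" "\<And>k. ups w' k + (if k \<in> S then 1 else 0) = ups w k"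
    by blast
  have "Suc ` S \<subseteq> peaks h (True # w)"
  proof
    fix x assume "x \<in> Suc ` S"
    then obtain y where y: "x = Suc y" "y \<in> S" by blast
    then show "x \<in> peaks h (True # w)" using S(1) peaks_Cons(1) by (cases y) auto
  qed
  moreover have "ups (True # w') k + (if k \<in> Suc ` S then 1 else 0) = ups (True # w) k" for k
    using S(2)[of "k - 1"] by (cases k) (auto simp: inj_image_mem_iff)
  ultimately show ?case by blast
next
  case (Down h w w')
  then obtain S where S: "S \<subseteq> peaks h w" "\<And>k. ups w' k + (if k \<in> S then 1 else 0) = ups w k"
    by blast
  have "Suc ` S \<subseteq> peaks (Suc h) (False # w)"
  proof
    fix x assume "x \<in> Suc ` S"
    then obtain y where y: "x = Suc y" "y \<in> S" by blast
    then show "x \<in> peaks (Suc h) (False # w)" using S(1) peaks_Cons(2) by (cases y) auto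
  qed
  moreover have "ups (False # w') k + (if k \<in> Suc ` S then 1 else 0) = ups (False # w) k" for k
    using S(2)[of "k - 1"] by (cases k) (auto simp: inj_image_mem_iff)
  ultimately show ?case by blast
next
  case (Flip h w w')
  then obtain S where S: "S \<subseteq> peaks (Suc h) w" "\<And>k. ups w' k + (if k \<in> S then 1 else 0) = ups w k"
    by blast
  have "insert 1 ((\<lambda>x. Suc (Suc x)) ` S) \<subseteq> peaks (Suc h) (True # False # w)"
  proof
    fix x assume "x \<in> insert 1 ((\<lambda>x. Suc (Suc x)) ` S)"
    then consider "x = 1" | y where "x = Suc (Suc y)" "y \<in> S" by blast
    then show "x \<in> peaks (Suc h) (True # False # w)"
    proof cases
      case 1
      then show ?thesis by (auto simp: peaks_def)
    next
      case 2
      then show ?thesis using S(1) peaks_Cons by (cases y) auto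
    qed
  qed
  moreover have "ups (False # True # w') k + (if k \<in> insert 1 ((\<lambda>x. Suc (Suc x)) ` S) then 1 else 0)
      = ups (True # False # w) k" for k
  proof (cases k)
    case (Suc l)
    then show ?thesis using S(2)[of "l - 1"] by (cases l) (auto simp: image_iff split: if_splits)
  qed auto
  ultimately show ?case by blast
qed

lemma flips_exists:
  assumes "dyck h w" "S \<subseteq> peaks h w"
  shows "\<exists>w'. flips h w w' \<and> (\<forall>k. ups w' k + (if k \<in> S then 1 else 0) = ups w k)"
  using assms
proof (induction "length w" arbitrary: h w S rule: less_induct)
  case less
  have S0: "0 \<notin> S" using less.prems by auto
  show ?case
  proof (cases w)
    case Nil
    then have "S = {}" using less.prems by (auto simp: peaks_def)
    then show ?thesis using Nil flips.Nil[of h] by (intro exI[of _ "[]"]) auto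
  next
    case (Cons b v)
    show ?thesis
    proof (cases "1 \<in> S")
      case True
      then have "1 \<in> peaks h w" using less.prems by auto
      then obtain u h' where wu: "w = True # False # u" "h = Suc h'"
        using Cons by (cases v; cases h) (auto simp: peaks_def split: if_splits)
      define S' where "S' = {k. Suc (Suc k) \<in> S}"
      \<comment> \<open>A down step follows the peak at 1, so 2 is not a peak and \<open>S'\<close>
        avoids 0.\<close>
      have 2: "Suc (Suc 0) \<notin> S"
      proof
        assume "Suc (Suc 0) \<in> S"
        then have "Suc (Suc 0) \<in> peaks h w" using less.prems by auto
        then show False using wu by (auto simp: peaks_def)
      qed
      have "S' \<subseteq> peaks h u"
      proof
        fix k assume "k \<in> S'"
        then have "Suc (Suc k) \<in> S" by (simp add: S'_def)
        moreover with 2 obtain k' where "k = Suc k'" by (cases k) auto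
        ultimately show "k \<in> peaks h u"
          using less.prems(2) wu peaks_Cons by auto
      qed
      moreover have "dyck h u" using less.prems wu by auto
      ultimately obtain u' where u': "flips h u u'" "\<And>k. ups u' k + (if k \<in> S' then 1 else 0) = ups u k"
        using less.hyps[of u h S'] wu by auto
      have "flips h w (False # True # u')" using u' wu flips.Flip by auto
      moreover have "ups (False # True # u') k + (if k \<in> S then 1 else 0) = ups w k" for k
      proof (cases k)
        case (Suc l)
        then show ?thesis using u'(2)[of "l - 1"] wu True S0 by (cases l) (auto simp: S'_def)
      qed (use S0 in simp)
      ultimately show ?thesis by blast
    next
      case False
      define S' where "S' = {k. Suc k \<in> S}"
      obtain h' where h': "if b then h' = Suc h else h = Suc h'"
        using less.prems Cons by (cases b; cases h) auto
      have "dyck h' v" using less.prems Cons h' by (cases b) auto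
      moreover have "S' \<subseteq> peaks h' v"
      proof
        fix k assume "k \<in> S'"
        then have "Suc k \<in> S" by (simp add: S'_def)
        moreover with False obtain k' where "k = Suc k'" by (cases k) auto
        ultimately show "k \<in> peaks h' v"
          using less.prems(2) Cons h' peaks_Cons by (cases b) auto
      qed
      ultimately obtain v' where v': "flips h' v v'" "\<And>k. ups v' k + (if k \<in> S' then 1 else 0) = ups v k"
        using less.hyps[of v h' S'] Cons by auto
      have "flips h w (b # v')" using v' Cons h' flips.Up flips.Down by (cases b) auto
      moreover have "ups (b # v') k + (if k \<in> S then 1 else 0) = ups w k" for k
        using v'(2)[of "k - 1"] Cons S0 by (cases k) (auto simp: S'_def)
      ultimately show ?thesis by blast
    qed
  qed
qed


section \<open>The bijection between Dyck words and order ideals\<close>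

text \<open>The root e_i - e_j is the cell whose top corner is the point after
  \<open>i + j - 1\<close> steps at height \<open>j - i + 1\<close>; it lies in the ideal when the
  path passes on or above that corner. Top corners have height at least 2, which is why
  \<open>n\<close> simple roots call for words of semilength \<open>n + 1\<close>.
  \<open>peak_root\<close> reads the correspondence backwards from a peak.\<close>

definition ideal_of_word :: "nat \<Rightarrow> bool list \<Rightarrow> (nat \<Rightarrow> int) set" where
  "ideal_of_word n w =
     {A_root i j | i j. 1 \<le> i \<and> i < j \<and> j \<le> n + 1 \<and> j \<le> ups w (i + j - 1)}"

definition peak_root :: "bool list \<Rightarrow> nat \<Rightarrow> nat \<Rightarrow> int" where
  "peak_root w k = A_root (k + 1 - ups w k) (ups w k)"

definition dyck_words :: "nat \<Rightarrow> bool list set" where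
  "dyck_words n = {w. length w = 2 * n + 2 \<and> dyck 0 w}"

lemma A_root_inject:
  assumes "i < j" "i' < j'"
  shows "A_root i j = A_root i' j' \<longleftrightarrow> i = i' \<and> j = j'"
proof
  assume eq: "A_root i j = A_root i' j'"
  have "A_root i j i = A_root i' j' i" "A_root i j j = A_root i' j' j" using eq by simp_all
  then show "i = i' \<and> j = j'" using assms by (auto simp: A_root_def split: if_splits)
qed simp

lemma A_root_mem_ideal_of_word:
  assumes "1 \<le> i" "i < j" "j \<le> n + 1"
  shows "A_root i j \<in> ideal_of_word n w \<longleftrightarrow> j \<le> ups w (i + j - 1)"
  using assms by (auto simp: ideal_of_word_def A_root_inject)

lemma ideal_of_word_ideal: "ideal_of_word n w \<in> carrier (order_ideals (A_root_poset n))"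
proof -
  have "ideal_of_word n w \<subseteq> carrier (A_root_poset n)"
    by (auto simp: ideal_of_word_def A_root_poset_def)
  moreover have "y \<in> ideal_of_word n w" if x: "x \<in> ideal_of_word n w"
    and y: "y \<in> carrier (A_root_poset n)" "y \<sqsubseteq>\<^bsub>A_root_poset n\<^esub> x" for x y
  proof -
    obtain i j where ij: "x = A_root i j" "1 \<le> i" "i < j" "j \<le> n + 1" "j \<le> ups w (i + j - 1)"
      using x by (auto simp: ideal_of_word_def)
    obtain i' j' where ij': "y = A_root i' j'" "1 \<le> i'" "i' < j'" "j' \<le> n + 1"
      using y by (auto simp: A_root_poset_def)
    have le: "i \<le> i'" "j' \<le> j" using A_root_poset_le_iff[of i' j' n i j] ij ij' y by auto
    have "ups w (i + j' - 1 + (j - j')) \<le> ups w (i + j' - 1) + (j - j')" by (rule ups_add_le)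
    moreover have "i + j' - 1 + (j - j') = i + j - 1" using le ij ij' by auto
    moreover have "ups w (i + j' - 1) \<le> ups w (i' + j' - 1)" using le by (intro ups_mono) auto
    ultimately have "j' \<le> ups w (i' + j' - 1)" using ij le by simp
    then show ?thesis using ij' by (auto simp: ideal_of_word_def)
  qed
  ultimately show ?thesis by (auto simp: order_ideals_def)
qed

lemma ups_dyck_words_le: "w \<in> dyck_words n \<Longrightarrow> ups w k \<le> n + 1"
  using dyck_ups_length[of 0 w] ups_mono[of k "length w" w] ups_beyond[of w k]
  by (cases "k \<le> length w") (auto simp: dyck_words_def)

lemma peak_root_props:
  assumes w: "w \<in> dyck_words n" and k: "k \<in> peaks 0 w"
  shows "1 \<le> k + 1 - ups w k" "k + 1 - ups w k < ups w k" "ups w k \<le> n + 1"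
    "(k + 1 - ups w k) + ups w k - 1 = k"
proof -
  show "1 \<le> k + 1 - ups w k" "(k + 1 - ups w k) + ups w k - 1 = k"
    using ups_le[of w k] by auto
  show "ups w k \<le> n + 1" by (rule ups_dyck_words_le[OF w])
  show "k + 1 - ups w k < ups w k"
    using k ups_le[of w k] by (auto simp: peaks_def)
qed

text \<open>The possible upper covers of e_i - e_j have their corners one step to the left or right
  and one unit higher. Their absence from the ideal forces an up step before and a down step after
  the corner of e_i - e_j, and conversely.\<close>

lemma maximal_in_ideal_of_word:
  assumes w: "w \<in> dyck_words n"
  shows "maximal_in (A_root_poset n) (ideal_of_word n w) = peak_root w ` peaks 0 w"
proof (intro equalityI subsetI)
  fix x assume "x \<in> maximal_in (A_root_poset n) (ideal_of_word n w)"
  then have x: "x \<in> ideal_of_word n w"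
    and max: "\<And>y. y \<in> ideal_of_word n w \<Longrightarrow> x \<sqsubseteq>\<^bsub>A_root_poset n\<^esub> y \<Longrightarrow> y = x"
    by (auto simp: maximal_in_def)
  obtain i j where ij: "x = A_root i j" "1 \<le> i" "i < j" "j \<le> n + 1" "j \<le> ups w (i + j - 1)"
    using x by (auto simp: ideal_of_word_def)
  define l where "l = i + j - 2"
  have k: "i + j - 1 = Suc l" using ij by (auto simp: l_def)
  have left: "ups w l < j"
  proof (rule ccontr)
    assume a: "\<not> ups w l < j"
    \<comment> \<open>For \<open>i = 1\<close> the prefix has only \<open>j - 1\<close> steps, too
      few for \<open>j\<close> up steps.\<close>
    then have i2: "2 \<le> i" using ups_le[of w l] ij by (auto simp: l_def)
    have e: "i - 1 + j - 1 = l" using i2 by (auto simp: l_def)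
    have "A_root (i - 1) j \<in> ideal_of_word n w"
      using A_root_mem_ideal_of_word[of "i - 1" j n w] i2 ij a unfolding e by auto
    moreover have "x \<sqsubseteq>\<^bsub>A_root_poset n\<^esub> A_root (i - 1) j"
      unfolding ij using ij i2 by (subst A_root_poset_le_iff) auto
    ultimately have "A_root (i - 1) j = A_root i j" using max ij by blast
    then have "i - 1 = i" using A_root_inject[of "i - 1" j i j] i2 ij by simp
    then show False using i2 by simp
  qed
  have right: "ups w (Suc (Suc l)) < j + 1"
  proof (rule ccontr)
    assume a: "\<not> ups w (Suc (Suc l)) < j + 1"
    then have jn: "j + 1 \<le> n + 1" using ups_dyck_words_le[OF w, of "Suc (Suc l)"] by auto
    have e: "i + (j + 1) - 1 = Suc (Suc l)" using ij by (auto simp: l_def)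
    have "A_root i (j + 1) \<in> ideal_of_word n w"
      using A_root_mem_ideal_of_word[of i "j + 1" n w] jn ij a unfolding e by auto
    moreover have "x \<sqsubseteq>\<^bsub>A_root_poset n\<^esub> A_root i (j + 1)"
      unfolding ij using ij jn by (subst A_root_poset_le_iff) auto
    ultimately have "A_root i (j + 1) = A_root i j" using max ij by blast
    then show False using A_root_inject[of i "j + 1" i j] ij by auto
  qed
  have u: "ups w (Suc l) = j" "ups w l = j - 1" "ups w (Suc (Suc l)) = j"
    using left right ij(5) ups_Suc_cases[of w l] ups_Suc_cases[of w "Suc l"] unfolding k by auto
  have "Suc (Suc l) \<le> length w"
    using w ij by (auto simp: dyck_words_def l_def)
  then have "Suc l \<in> peaks 0 w" using u ij by (auto simp: peaks_def l_def)
  moreover have "Suc l + 1 - j = i" using ij by (auto simp: l_def)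
  then have "peak_root w (Suc l) = x" using u ij by (simp add: peak_root_def)
  ultimately show "x \<in> peak_root w ` peaks 0 w" by blast
next
  fix x assume "x \<in> peak_root w ` peaks 0 w"
  then obtain k where k: "k \<in> peaks 0 w" "x = peak_root w k" by blast
  define i where "i = k + 1 - ups w k"
  define j where "j = ups w k"
  have ij: "1 \<le> i" "i < j" "j \<le> n + 1" "i + j - 1 = k"
    using peak_root_props[OF w k(1)] by (auto simp: i_def j_def)
  have x: "x = A_root i j" by (simp add: k peak_root_def i_def j_def)
  obtain l where l: "k = Suc l" "ups w (Suc l) = Suc (ups w l)" "ups w (Suc (Suc l)) = ups w (Suc l)"
    using k by (auto simp: peaks_def)
  show "x \<in> maximal_in (A_root_poset n) (ideal_of_word n w)"
    unfolding maximal_in_def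
  proof (clarsimp, intro conjI ballI impI)
    show "x \<in> ideal_of_word n w" unfolding x using A_root_mem_ideal_of_word[of i j n w] ij
      by (auto simp: j_def)
    fix y assume y: "y \<in> ideal_of_word n w" "x \<sqsubseteq>\<^bsub>A_root_poset n\<^esub> y"
    then obtain i' j' where ij': "y = A_root i' j'" "1 \<le> i'" "i' < j'" "j' \<le> n + 1" "j' \<le> ups w (i' + j' - 1)"
      by (auto simp: ideal_of_word_def)
    have le: "i' \<le> i" "j \<le> j'" using A_root_poset_le_iff[of i j n i' j'] ij ij' y x by auto
    have "i' = i"
    proof (rule ccontr)
      assume "i' \<noteq> i"
      then have "i' < i" using le by simp
      then have "i' + j' - 1 \<le> l + (j' - j)" using l ij le by auto
      then have "ups w (i' + j' - 1) \<le> ups w (l + (j' - j))" by (rule ups_mono)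
      also have "\<dots> \<le> ups w l + (j' - j)" by (rule ups_add_le)
      finally show False using ij' l le unfolding j_def by auto
    qed
    moreover have "j' = j"
    proof (rule ccontr)
      assume "j' \<noteq> j"
      then have "j < j'" using le by simp
      then have "i' + j' - 1 \<le> Suc (Suc l) + (j' - j - 1)" using l ij le by auto
      then have "ups w (i' + j' - 1) \<le> ups w (Suc (Suc l) + (j' - j - 1))" by (rule ups_mono)
      also have "\<dots> \<le> ups w (Suc (Suc l)) + (j' - j - 1)" by (rule ups_add_le)
      finally show False using ij' l \<open>j < j'\<close> unfolding j_def by auto
    qed
    ultimately show "y = x" using x ij' by simp
  qed
qed

lemma ideal_of_word_lower:
  assumes w: "w \<in> dyck_words n" and S: "S \<subseteq> peaks 0 w"
    and w': "\<And>k. ups w' k + (if k \<in> S then 1 else 0) = ups w k"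
  shows "ideal_of_word n w' = ideal_of_word n w - peak_root w ` S"
proof -
  have *: "A_root i j \<in> ideal_of_word n w' \<longleftrightarrow> A_root i j \<in> ideal_of_word n w - peak_root w ` S"
    if ij: "1 \<le> i" "i < j" "j \<le> n + 1" for i j
  proof -
    have "A_root i j \<in> peak_root w ` S \<longleftrightarrow> i + j - 1 \<in> S \<and> j = ups w (i + j - 1)"
    proof
      assume "A_root i j \<in> peak_root w ` S"
      then obtain k where k: "k \<in> S" "A_root i j = peak_root w k" by blast
      then have "i = k + 1 - ups w k" "j = ups w k"
        using A_root_inject[of i j "k + 1 - ups w k" "ups w k"] peak_root_props[OF w, of k] S ij
        by (auto simp: peak_root_def)
      then show "i + j - 1 \<in> S \<and> j = ups w (i + j - 1)"
        using peak_root_props[OF w, of k] k S by auto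
    next
      assume a: "i + j - 1 \<in> S \<and> j = ups w (i + j - 1)"
      then have "peak_root w (i + j - 1) = A_root i j"
        using ij by (auto simp: peak_root_def)
      then show "A_root i j \<in> peak_root w ` S" using a by (metis imageI)
    qed
    then show ?thesis
      using w'[of "i + j - 1"] ij by (auto simp: A_root_mem_ideal_of_word split: if_splits)
  qed
  have sub: "\<exists>i j. x = A_root i j \<and> 1 \<le> i \<and> i < j \<and> j \<le> n + 1"
    if "x \<in> ideal_of_word n v" for x v
    using that by (auto simp: ideal_of_word_def)
  show ?thesis
  proof (intro equalityI subsetI)
    fix x assume x: "x \<in> ideal_of_word n w'"
    from sub[OF x] obtain i j where "x = A_root i j" "1 \<le> i" "i < j" "j \<le> n + 1" by blast
    with *[of i j] x show "x \<in> ideal_of_word n w - peak_root w ` S" by simp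
  next
    fix x assume x: "x \<in> ideal_of_word n w - peak_root w ` S"
    from sub[of x w] x obtain i j where "x = A_root i j" "1 \<le> i" "i < j" "j \<le> n + 1" by blast
    with *[of i j] x show "x \<in> ideal_of_word n w'" by simp
  qed
qed

lemma nontrivial_Ungar_moves_ideal_of_word:
  assumes w: "w \<in> dyck_words n"
  shows "nontrivial_Ungar_moves (order_ideals (A_root_poset n)) (ideal_of_word n w)
    = ideal_of_word n ` {w'. flips 0 w w' \<and> w' \<noteq> w}"
  unfolding nontrivial_Ungar_moves_order_ideals[OF partial_order_A_root_poset finite_A_root_poset ideal_of_word_ideal]
    maximal_in_ideal_of_word[OF w]
proof (intro equalityI subsetI)
  fix J assume "J \<in> {ideal_of_word n w - M |M. M \<subseteq> peak_root w ` peaks 0 w \<and> M \<noteq> {}}"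
  then obtain S where S: "J = ideal_of_word n w - peak_root w ` S" "S \<subseteq> peaks 0 w" "S \<noteq> {}"
    by (auto simp: subset_image_iff)
  obtain w' where w': "flips 0 w w'" "\<And>k. ups w' k + (if k \<in> S then 1 else 0) = ups w k"
    using flips_exists[of 0 w S] w S by (auto simp: dyck_words_def)
  obtain k where "k \<in> S" using S by blast
  with w'(2)[of k] have "w' \<noteq> w" by auto
  then show "J \<in> ideal_of_word n ` {w'. flips 0 w w' \<and> w' \<noteq> w}"
    using w' S ideal_of_word_lower[OF w S(2) w'(2)] by auto
next
  fix J assume "J \<in> ideal_of_word n ` {w'. flips 0 w w' \<and> w' \<noteq> w}"
  then obtain w' where w': "flips 0 w w'" "w' \<noteq> w" "J = ideal_of_word n w'" by blast
  obtain S where S: "S \<subseteq> peaks 0 w" "\<And>k. ups w' k + (if k \<in> S then 1 else 0) = ups w k"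
    using flips_ups[OF w'(1)] by blast
  have "S \<noteq> {}"
  proof
    assume "S = {}"
    then have "w' = w" using S(2) flips_length[OF w'(1)] by (intro ups_inject) auto
    then show False using w' by simp
  qed
  then show "J \<in> {ideal_of_word n w - M |M. M \<subseteq> peak_root w ` peaks 0 w \<and> M \<noteq> {}}"
    using S ideal_of_word_lower[OF w S] w' by blast
qed

text \<open>At a prefix where \<open>w\<close> had more up steps than \<open>w'\<close>, the point
  on the path of \<open>w\<close> would be the corner of a root in the first ideal only. It is a
  root, that is \<open>i < j\<close>, because up steps make up at least half of the prefix of
  \<open>w'\<close> and \<open>w\<close> has more of them.\<close>

lemma ideal_of_word_determines_ups:
  assumes w: "w \<in> dyck_words n" and w': "w' \<in> dyck_words n"
    and eq: "ideal_of_word n w \<subseteq> ideal_of_word n w'"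
  shows "ups w k \<le> ups w' k"
proof -
  have main: "ups w k \<le> ups w' k" if kl: "k \<le> 2 * n + 2" for k
  proof (rule ccontr)
    assume a: "\<not> ups w k \<le> ups w' k"
    define j where "j = ups w k"
    define i where "i = k + 1 - j"
    have "k \<le> 2 * ups w' k" using dyck_height[of 0 w' k] w' kl by (auto simp: dyck_words_def)
    then have ij: "1 \<le> i" "i < j" "j \<le> n + 1" "i + j - 1 = k"
      using a ups_le[of w k] ups_dyck_words_le[OF w, of k] by (auto simp: i_def j_def)
    then have "A_root i j \<in> ideal_of_word n w"
      by (simp add: A_root_mem_ideal_of_word j_def)
    then have "A_root i j \<in> ideal_of_word n w'" using eq by blast
    then show False using ij a by (simp add: A_root_mem_ideal_of_word j_def)
  qed
  show ?thesis
    using main[of k] main[of "2 * n + 2"] ups_beyond[of w k] ups_beyond[of w' k] w w'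
    by (cases "k \<le> 2 * n + 2") (auto simp: dyck_words_def)
qed

lemma inj_on_ideal_of_word: "inj_on (ideal_of_word n) (dyck_words n)"
proof (rule inj_onI)
  fix w w' assume *: "w \<in> dyck_words n" "w' \<in> dyck_words n" "ideal_of_word n w = ideal_of_word n w'"
  have "ups w k = ups w' k" for k
    using ideal_of_word_determines_ups[of w n w' k] ideal_of_word_determines_ups[of w' n w k] *
    by auto
  then show "w = w'" using * by (intro ups_inject) (auto simp: dyck_words_def)
qed

text \<open>
  Surjectivity: adding a minimal element of the complement is the inverse of an Ungar move, so
  every ideal is reached from the full poset by lowering peaks.
\<close>

lemma ideal_of_word_surj:
  assumes "J \<in> carrier (order_ideals (A_root_poset n))"
  shows "J \<in> ideal_of_word n ` dyck_words n"
  using assms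
proof (induction "card (carrier (A_root_poset n) - J)" arbitrary: J rule: less_induct)
  case less
  let ?P = "A_root_poset n"
  have sub: "J \<subseteq> carrier ?P" using less.prems by (auto simp: order_ideals_def)
  show ?case
  proof (cases "J = carrier ?P")
    case True
    define w where "w = replicate (n + 1) True @ replicate (n + 1) False"
    have "w \<in> dyck_words n" using dyck_replicate[of 0 "n + 1"] by (auto simp: w_def dyck_words_def)
    moreover have "ideal_of_word n w = J"
    proof -
      have "j \<le> ups w (i + j - 1)" if "1 \<le> i" "i < j" "j \<le> n + 1" for i j
        unfolding w_def ups_replicate using that by auto
      then show ?thesis unfolding True by (auto simp: ideal_of_word_def A_root_poset_def)
    qed
    ultimately show ?thesis by blast
  next
    case False
    then obtain x where x: "x \<notin> J" "x \<in> carrier ?P" "insert x J \<in> carrier (order_ideals ?P)"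
      "x \<in> maximal_in ?P (insert x J)"
      using exists_maximal_insert_ideal[OF partial_order_A_root_poset finite_A_root_poset less.prems]
      by blast
    have "card (carrier ?P - insert x J) < card (carrier ?P - J)"
      using x finite_A_root_poset by (intro psubset_card_mono) auto
    from less.hyps[OF this x(3)] obtain w where w: "w \<in> dyck_words n" "insert x J = ideal_of_word n w"
      by blast
    have "J = insert x J - {x}" using x by auto
    then have "J \<in> nontrivial_Ungar_moves (order_ideals ?P) (insert x J)"
      unfolding nontrivial_Ungar_moves_order_ideals[OF partial_order_A_root_poset finite_A_root_poset x(3)]
      using x(4) by (intro CollectI exI[of _ "{x}"]) auto
    then have "J \<in> ideal_of_word n ` {w'. flips 0 w w' \<and> w' \<noteq> w}"
      unfolding w(2) nontrivial_Ungar_moves_ideal_of_word[OF w(1)] .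
    then show ?thesis
      using flips_length flips_dyck w(1) by (fastforce simp: dyck_words_def)
  qed
qed

section \<open>The winning positions\<close>

text \<open>
  The word \<open>U v D\<close> between consecutive returns to height 0 is accepted if the automaton,
  started in \<open>QA\<close>, reads \<open>v\<close> and stops in \<open>QA\<close> or \<open>QE\<close>; \<open>QX\<close> is the dead state.
\<close>

datatype state = QA | QB | QC | QE | QX

fun step :: "state \<Rightarrow> bool \<Rightarrow> state" where
  "step QA b = (if b then QB else QA)"
| "step QB b = (if b then QA else QC)"
| "step QC b = (if b then QX else QE)"
| "step QE b = (if b then QB else QC)"
| "step QX b = QX"

fun acc :: "nat \<Rightarrow> state \<Rightarrow> bool list \<Rightarrow> bool" where
  "acc h q [] \<longleftrightarrow> h = 0"
| "acc 0 q (b # w) \<longleftrightarrow> b \<and> acc 1 QA w"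
| "acc (Suc h) q (True # w) \<longleftrightarrow> acc (Suc (Suc h)) (step q True) w"
| "acc (Suc 0) q (False # w) \<longleftrightarrow> (q = QA \<or> q = QE) \<and> acc 0 QA w"
| "acc (Suc (Suc h)) q (False # w) \<longleftrightarrow> acc (Suc h) (step q False) w"

section \<open>Kernel property of the accepted words\<close>

lemma acc_dyck: "acc h q w \<Longrightarrow> dyck h w"
  by (induction h q w rule: acc.induct) auto

lemma not_acc_X [simp]: "\<not> acc (Suc h) QX w"
proof (induction w arbitrary: h)
  case (Cons b w)
  then show ?case by (cases b; cases h) auto
qed simp

lemma not_acc_1_C [simp]: "\<not> acc (Suc 0) QC w"
proof (cases w)
  case (Cons b v)
  then show ?thesis by (cases b) auto
qed simp

text \<open>These are the pairs of states that can arise once a peak is lowered at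
  \<open>QA\<close>, where UD leads to \<open>QC\<close> and DU to \<open>QB\<close>. Each pair
  contains \<open>QC\<close>, which dies on an up step. Common down steps and further lowered peaks
  stay among the three pairs, and at height one \<open>QC\<close> cannot finish.\<close>

lemma flips_acc_incompatible:
  assumes "flips h w w'" "h \<noteq> 0"
  shows "\<not> (acc h QC w \<and> acc h QB w') \<and> \<not> (acc h QE w \<and> acc h QC w') \<and> \<not> (acc h QC w \<and> acc h QE w')"
  using assms
proof (induction rule: flips.induct)
  case (Up h w w')
  then show ?case by (cases h rule: nat.exhaust) auto
next
  case (Down h w w')
  then show ?case by (cases h rule: nat.exhaust) auto
next
  case (Flip h w w')
  then show ?case by (cases h rule: nat.exhaust) auto
qed auto

text \<open>At a lowered peak above height one, DU dies from \<open>QB\<close> and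
  \<open>QE\<close>, UD dies from \<open>QC\<close>, and from \<open>QA\<close> the states split as
  in \<open>flips_acc_incompatible\<close>. At height one UD is rejected except from
  \<open>QB\<close>, where DU is.\<close>

lemma flips_acc_unique:
  assumes "flips h w w'" "acc h q w" "acc h q w'"
  shows "w = w'"
  using assms
proof (induction arbitrary: q rule: flips.induct)
  case (Up h w w')
  then show ?case by (cases h rule: nat.exhaust) auto
next
  case (Down h w w')
  then show ?case by (cases h rule: nat.exhaust) auto
next
  case (Flip h w w')
  then show ?case using flips_acc_incompatible[OF Flip.hyps] by (cases h rule: nat.exhaust; cases q) auto
qed auto

text \<open>The first clause is the goal; the others describe what a choice at a peak leaves open.
  Before UD at \<open>QA\<close>, keeping the peak leads to \<open>QC\<close> and lowering it to
  \<open>QB\<close>; before UD with \<open>QC\<close> or \<open>QE\<close> available, keeping from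
  \<open>QE\<close> and lowering from \<open>QC\<close> lead to the same two states. So only
  disjunctions are inductive. A down step sends the pair \<open>QB\<close>, \<open>QC\<close> to
  \<open>QC\<close>, \<open>QE\<close> and swaps the latter two. The last clause serves words with
  two up steps in a row, since \<open>QB\<close> goes to \<open>QA\<close> on the second.\<close>

lemma flips_acc_exists_aux:
  assumes "dyck h v"
  defines "sol \<equiv> \<lambda>h q v. \<exists>v'. flips h v v' \<and> acc h q v'"
  shows "sol h QA v \<and> (h \<noteq> 0 \<longrightarrow> sol h QC v \<or> sol h QE v)
    \<and> (1 < h \<longrightarrow> sol h QB v \<or> sol h QC v) \<and> (1 < h \<and> v \<noteq> [] \<and> hd v \<longrightarrow> sol h QB v)"
  using assms(1)
proof (induction "length v" arbitrary: h v rule: less_induct)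
  case less
  have up: "sol (Suc h) q (True # v)" if "sol (Suc (Suc h)) (step q True) v" for h q v
    using that flips.Up unfolding sol_def by (metis acc.simps(3))
  have up0: "sol 0 q (True # v)" if "sol (Suc 0) QA v" for q v
    using that flips.Up[of 0 v] unfolding sol_def by (metis One_nat_def acc.simps(2))
  have down: "sol (Suc (Suc h)) q (False # v)" if "sol (Suc h) (step q False) v" for h q v
    using that flips.Down unfolding sol_def by (metis acc.simps(5))
  have down1: "sol (Suc 0) q (False # v)" if "sol 0 QA v" "q = QA \<or> q = QE" for q v
    using that flips.Down[of 0 v] unfolding sol_def by (metis acc.simps(4))
  have flip: "sol (Suc (Suc h)) q (True # False # v)"
    if "sol (Suc (Suc h)) (step (step q False) True) v" for h q v
    using that flips.Flip[of "Suc h" v] unfolding sol_def by (metis acc.simps(3,5))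
  have flip1: "sol (Suc 0) q (True # False # v)"
    if v: "sol (Suc 0) QA v" and q: "q = QA \<or> q = QE" for q v
  proof -
    obtain v' where "flips (Suc 0) v v'" "acc (Suc 0) QA v'" using v unfolding sol_def by blast
    then have "flips (Suc 0) (True # False # v) (False # True # v')"
      "acc (Suc 0) q (False # True # v')"
      using q flips.Flip[of 0] by auto
    then show ?thesis unfolding sol_def by blast
  qed
  show ?case
  proof (cases v)
    case Nil
    then have "h = 0" using less.prems by simp
    then show ?thesis using Nil flips.Nil unfolding sol_def by (auto intro!: exI[of _ "[]"])
  next
    case (Cons b u)
    show ?thesis
    proof (cases b)
      case False
      then obtain h' where h': "h = Suc h'" "dyck h' u" using less.prems Cons by (cases h) auto
      note IH = less.hyps[OF _ h'(2)]
      show ?thesis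
      proof (cases h')
        case 0
        then show ?thesis using IH Cons False h' down1[of u] by auto
      next
        case (Suc h'')
        then show ?thesis using IH Cons False h' down[of h'' _ u] by auto
      qed
    next
      case True
      then have u: "dyck (Suc h) u" using less.prems Cons by auto
      note IHu = less.hyps[OF _ u]
      show ?thesis
      proof (cases h)
        case 0
        then show ?thesis using IHu Cons True up0[of u] by auto
      next
        case (Suc h')
        obtain c u' where cu: "u = c # u'" using u by (cases u) auto
        have QB: "sol h QB v" if "1 < h"
          using that IHu Cons True Suc up[of h' QB u] by auto
        show ?thesis
        proof (cases c)
          case True
          then show ?thesis using QB IHu Cons \<open>b\<close> Suc cu up[of h' QA u] up[of h' QE u] by auto
        next
          case False
          then have u': "dyck h u'" using u cu by auto
          have IH': "sol h QA u' \<and> (h \<noteq> 0 \<longrightarrow> sol h QC u' \<or> sol h QE u')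
            \<and> (1 < h \<longrightarrow> sol h QB u' \<or> sol h QC u')"
            using less.hyps[OF _ u'] Cons cu by auto
          have keep: "sol h q (True # False # u')" if "sol h (step (step q True) False) u'" for q
            using that up[of h' q "False # u'"] down[of h' "step q True" u'] Suc by auto
          show ?thesis
          proof (cases h')
            case 0
            \<comment> \<open>At height one a lowered peak touches the axis and the automaton
              restarts in \<open>QA\<close>, so the first clause alone suffices.\<close>
            then show ?thesis using flip1[of u'] IH' Suc Cons cu False \<open>b\<close> by auto
          next
            case (Suc h'')
            then show ?thesis
              using IH' QB keep[of QA] keep[of QE] flip[of h'' QA u'] flip[of h'' QC u'] \<open>h = Suc h'\<close>
                Cons cu False \<open>b\<close> by auto
          qed
        qed
      qed
    qed
  qed
qed

lemma flips_acc_exists: "dyck 0 w \<Longrightarrow> \<exists>w'. flips 0 w w' \<and> acc 0 QA w'"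
  using flips_acc_exists_aux by blast

lemma Eeta_win_ideal_of_word:
  assumes "w \<in> dyck_words n"
  shows "Eeta_win (order_ideals (A_root_poset n)) (ideal_of_word n w) \<longleftrightarrow> acc 0 QA w"
  using assms
proof (induction "card (ideal_of_word n w)" arbitrary: w rule: less_induct)
  case less
  let ?L = "order_ideals (A_root_poset n)"
  have fin: "finite (carrier ?L)" by (rule finite_order_ideals[OF finite_A_root_poset])
  have IH: "Eeta_win ?L (ideal_of_word n w') \<longleftrightarrow> acc 0 QA w'" if w': "flips 0 w w'" "w' \<noteq> w" for w'
  proof (rule less.hyps)
    show "w' \<in> dyck_words n"
      using less.prems w' flips_length flips_dyck by (auto simp: dyck_words_def)
    have "ideal_of_word n w' \<in> nontrivial_Ungar_moves ?L (ideal_of_word n w)"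
      unfolding nontrivial_Ungar_moves_ideal_of_word[OF less.prems] using w' by blast
    from nontrivial_Ungar_moveD[OF lattice_order_ideals fin ideal_of_word_ideal this]
    have "ideal_of_word n w' \<subset> ideal_of_word n w" by (auto simp: order_ideals_def)
    moreover have "finite (ideal_of_word n w)"
      by (rule finite_subset[OF _ finite_A_root_poset[of n]]) (auto simp: ideal_of_word_def A_root_poset_def)
    ultimately show "card (ideal_of_word n w') < card (ideal_of_word n w)"
      by (rule psubset_card_mono[rotated])
  qed
  have "Eeta_win ?L (ideal_of_word n w)
      \<longleftrightarrow> (\<forall>y\<in>nontrivial_Ungar_moves ?L (ideal_of_word n w). \<not> Eeta_win ?L y)"
    by (subst Eeta_win.simps) (use fin lattice_order_ideals ideal_of_word_ideal in auto)
  also have "\<dots> \<longleftrightarrow> (\<forall>w'. flips 0 w w' \<and> w' \<noteq> w \<longrightarrow> \<not> acc 0 QA w')"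
    unfolding nontrivial_Ungar_moves_ideal_of_word[OF less.prems] using IH by auto
  \<comment> \<open>The accepted word found by \<open>flips_acc_exists\<close> may be
    \<open>w\<close> itself; by uniqueness this happens exactly when \<open>w\<close> is
    accepted.\<close>
  also have "\<dots> \<longleftrightarrow> acc 0 QA w"
    using flips_acc_exists[of w] flips_acc_unique[of 0 w _ QA] less.prems
    by (auto simp: dyck_words_def)
  finally show ?case .
qed

lemma card_Eeta_wins:
  "card (Eeta_wins (order_ideals (A_root_poset n))) = card {w. length w = 2 * n + 2 \<and> acc 0 QA w}"
proof -
  let ?W = "{w. length w = 2 * n + 2 \<and> acc 0 QA w}"
  have sub: "?W \<subseteq> dyck_words n" using acc_dyck by (auto simp: dyck_words_def)
  have "Eeta_wins (order_ideals (A_root_poset n)) = ideal_of_word n ` ?W"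
  proof (intro equalityI subsetI)
    fix J assume J: "J \<in> Eeta_wins (order_ideals (A_root_poset n))"
    then obtain w where w: "w \<in> dyck_words n" "J = ideal_of_word n w"
      using ideal_of_word_surj[of J n] by (auto simp: Eeta_wins_def)
    then show "J \<in> ideal_of_word n ` ?W"
      using J Eeta_win_ideal_of_word[OF w(1)] by (auto simp: Eeta_wins_def dyck_words_def)
  next
    fix J assume "J \<in> ideal_of_word n ` ?W"
    then show "J \<in> Eeta_wins (order_ideals (A_root_poset n))"
      using sub Eeta_win_ideal_of_word ideal_of_word_ideal by (auto simp: Eeta_wins_def)
  qed
  then show ?thesis
    using card_image[OF inj_on_subset[OF inj_on_ideal_of_word sub]] by simp
qed


section \<open>Counting the winning positions\<close>

datatype tree = Lf | Nd tree tree

primrec nodes :: "tree \<Rightarrow> nat" where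
  "nodes Lf = 0"
| "nodes (Nd u v) = Suc (nodes u + nodes v)"

primrec word :: "tree \<Rightarrow> bool list" where
  "word Lf = []"
| "word (Nd u v) = word u @ True # word v @ [False]"

primrec run :: "tree \<Rightarrow> state \<Rightarrow> state" where
  "run Lf q = q"
| "run (Nd u v) q = step (run v (step (run u q) True)) False"

text \<open>Concatenation of Dyck words on trees: the first tree is hung at the end of the left
  spine of the second. It reconciles splitting a word from its first step with \<open>word\<close>,
  which cuts at the last return.\<close>

primrec graft :: "tree \<Rightarrow> tree \<Rightarrow> tree" where
  "graft t Lf = t"
| "graft t (Nd u v) = Nd (graft t u) v"

primrec good :: "tree \<Rightarrow> bool" where
  "good Lf \<longleftrightarrow> True"
| "good (Nd u v) \<longleftrightarrow> good u \<and> run v QA \<in> {QA, QE}"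

lemma word_graft: "word (graft t u) = word t @ word u"
  by (induction u) auto

lemma length_word: "length (word t) = 2 * nodes t"
  by (induction t) auto

lemma run_X [simp]: "run t QX = QX"
  by (induction t) auto

text \<open>Inside \<open>word t\<close> the height never falls below its positive starting value,
  so no return to the axis is met and \<open>acc\<close> merely iterates
  \<open>step\<close>.\<close>

lemma acc_word: "acc (Suc h) q (word t @ r) \<longleftrightarrow> acc (Suc h) (run t q) r"
  by (induction t arbitrary: h q r) auto

lemma acc_word_0: "acc 0 QA (word t @ r) \<longleftrightarrow> good t \<and> acc 0 QA r"
proof (induction t arbitrary: r)
  case (Nd u v)
  then show ?case by (auto simp: acc_word)
qed auto

lemma dyck_word_split:
  "dyck (Suc h) w \<Longrightarrow> \<exists>t r. w = word t @ False # r \<and> dyck h r"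
proof (induction "length w" arbitrary: h w rule: less_induct)
  case less
  then obtain b v where w: "w = b # v" by (cases w) auto
  show ?case
  proof (cases b)
    case False
    then show ?thesis using less.prems w by (intro exI[of _ Lf] exI[of _ v]) auto
  next
    case True
    then obtain t r where t: "v = word t @ False # r" "dyck (Suc h) r"
      using less.hyps[of v "Suc h"] less.prems w by auto
    then obtain t' r' where t': "r = word t' @ False # r'" "dyck h r'"
      using less.hyps[of r h] w by auto
    show ?thesis
      using t t' w True by (intro exI[of _ "graft (Nd Lf t) t'"] exI[of _ r']) (auto simp: word_graft)
  qed
qed

lemma dyck_word_exists: "dyck 0 w \<Longrightarrow> \<exists>t. w = word t"
proof (induction "length w" arbitrary: w rule: less_induct)
  case less
  show ?case
  proof (cases w)
    case Nil
    then show ?thesis by (intro exI[of _ Lf]) auto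
  next
    case (Cons b v)
    then have b: "b" "dyck (Suc 0) v" using less.prems by (cases b; simp)+
    then obtain t r where t: "v = word t @ False # r" "dyck 0 r"
      using dyck_word_split by blast
    then obtain t' where "r = word t'" using less.hyps[of r] Cons by auto
    then show ?thesis using t b Cons by (intro exI[of _ "graft (Nd Lf t) t'"]) (auto simp: word_graft)
  qed
qed

text \<open>Parsing from the right: the opening up step of a final balanced block is the last
  unmatched one. The arbitrary prefix \<open>r\<close> is needed because peeling off the last arch
  leaves a longer prefix in front of it.\<close>

lemma word_suffix_inject: "r @ True # word t = r' @ True # word t' \<Longrightarrow> r = r' \<and> t = t'"
proof (induction t arbitrary: r r' t')
  case Lf
  show ?case
  proof (cases t')
    case (Nd u v)
    have "last (r @ True # word Lf) = True" "last (r' @ True # word (Nd u v)) = False" by auto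
    then show ?thesis using Lf Nd by metis
  qed (use Lf in auto)
next
  case (Nd u v)
  show ?case
  proof (cases t')
    case Lf
    have "last (r @ True # word (Nd u v)) = False" "last (r' @ True # word Lf) = True" by auto
    then show ?thesis using Lf Nd.prems by metis
  next
    case t': (Nd u' v')
    have "(r @ True # word u) @ True # word v = (r' @ True # word u') @ True # word v'"
      using Nd.prems t' by simp
    from Nd.IH(2)[OF this] have "v = v'" "r @ True # word u = r' @ True # word u'" by auto
    then show ?thesis using Nd.IH(1) t' by blast
  qed
qed

lemma inj_word: "inj word"
proof (rule injI)
  fix t t' assume "word t = word t'"
  then show "t = t'" using word_suffix_inject[of "[]" t "[]" t'] by simp
qed

lemma finite_nodes: "finite {t. nodes t = m \<and> P t}"
proof (rule finite_subset)
  show "{t. nodes t = m \<and> P t} \<subseteq> word -` {w. set w \<subseteq> UNIV \<and> length w = 2 * m}"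
    by (auto simp: length_word)
  show "finite (word -` {w. set w \<subseteq> UNIV \<and> length w = 2 * m})"
    by (rule finite_vimageI[OF finite_lists_length_eq inj_word]) simp
qed

section \<open>Generating functions and the algebraic system\<close>

definition tree_gf :: "(tree \<Rightarrow> bool) \<Rightarrow> real fps" where
  "tree_gf P = Abs_fps (\<lambda>m. real (card {t. nodes t = m \<and> P t}))"

lemma card_Eeta_wins_eq_tree_gf:
  "real (card (Eeta_wins (order_ideals (A_root_poset n)))) = fps_nth (tree_gf good) (Suc n)"
proof -
  have "{w. length w = 2 * n + 2 \<and> acc 0 QA w} = word ` {t. nodes t = Suc n \<and> good t}"
  proof (intro equalityI subsetI)
    fix w assume w: "w \<in> {w. length w = 2 * n + 2 \<and> acc 0 QA w}"
    then obtain t where t: "w = word t" using acc_dyck dyck_word_exists by blast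
    then show "w \<in> word ` {t. nodes t = Suc n \<and> good t}"
      using w acc_word_0[of t "[]"] by (auto simp: length_word)
  next
    fix w assume "w \<in> word ` {t. nodes t = Suc n \<and> good t}"
    then obtain t where "w = word t" "nodes t = Suc n" "good t" by blast
    then show "w \<in> {w. length w = 2 * n + 2 \<and> acc 0 QA w}"
      using acc_word_0[of t "[]"] by (auto simp: length_word)
  qed
  then show ?thesis
    using card_image[OF inj_on_subset[OF inj_word]] by (simp add: card_Eeta_wins tree_gf_def)
qed

lemma tree_gf_Nd:
  assumes P: "\<And>u v. P (Nd u v) \<longleftrightarrow> Q u \<and> R v \<or> Q' u \<and> R' v"
    and disj: "\<And>u. \<not> (Q u \<and> Q' u)"
  shows "tree_gf P = of_bool (P Lf) + fps_X * (tree_gf Q * tree_gf R + tree_gf Q' * tree_gf R')"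
proof (rule fps_ext)
  fix m
  show "fps_nth (tree_gf P) m
    = fps_nth (of_bool (P Lf) + fps_X * (tree_gf Q * tree_gf R + tree_gf Q' * tree_gf R')) m"
  proof (cases m)
    case 0
    have "{t. nodes t = 0 \<and> P t} = (if P Lf then {Lf} else {})"
    proof -
      have "nodes t = 0 \<longleftrightarrow> t = Lf" for t by (cases t) auto
      then show ?thesis by auto
    qed
    then show ?thesis using 0 by (simp add: tree_gf_def)
  next
    case (Suc k)
    define S where "S = (\<lambda>Q i. {t. nodes t = i \<and> Q t})"
    define Z where "Z = (\<lambda>i. (\<lambda>(u, v). Nd u v) ` (S Q i \<times> S R (k - i) \<union> S Q' i \<times> S R' (k - i)))"
    have fin: "finite (S Q i)" for Q i unfolding S_def by (rule finite_nodes)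
    have "{t. nodes t = Suc k \<and> P t} = (\<Union>i\<in>{0..k}. Z i)"
    proof (intro equalityI subsetI)
      fix t assume t: "t \<in> {t. nodes t = Suc k \<and> P t}"
      then obtain u v where uv: "t = Nd u v" by (cases t) auto
      then have "nodes v = k - nodes u" "nodes u \<in> {0..k}" using t by auto
      then show "t \<in> (\<Union>i\<in>{0..k}. Z i)"
        using t uv P by (auto simp: Z_def S_def)
    next
      fix t assume "t \<in> (\<Union>i\<in>{0..k}. Z i)"
      then show "t \<in> {t. nodes t = Suc k \<and> P t}" using P by (auto simp: Z_def S_def)
    qed
    moreover have "card (\<Union>i\<in>{0..k}. Z i) = (\<Sum>i=0..k. card (Z i))"
    proof (rule card_UN_disjoint)
      show "\<forall>i\<in>{0..k}. finite (Z i)" using fin by (auto simp: Z_def)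
      show "\<forall>i\<in>{0..k}. \<forall>j\<in>{0..k}. i \<noteq> j \<longrightarrow> Z i \<inter> Z j = {}"
        by (auto simp: Z_def S_def)
    qed simp
    moreover have "card (Z i) = card (S Q i) * card (S R (k - i)) + card (S Q' i) * card (S R' (k - i))" for i
    proof -
      have "card (Z i) = card (S Q i \<times> S R (k - i) \<union> S Q' i \<times> S R' (k - i))"
        unfolding Z_def by (rule card_image) (auto simp: inj_on_def)
      also have "\<dots> = card (S Q i \<times> S R (k - i)) + card (S Q' i \<times> S R' (k - i))"
        using fin disj by (intro card_Un_disjoint finite_cartesian_product) (auto simp: S_def)
      finally show ?thesis by (simp add: card_cartesian_product)
    qed
    ultimately have "real (card {t. nodes t = Suc k \<and> P t})
      = (\<Sum>i=0..k. real (card (S Q i)) * real (card (S R (k - i)))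
          + real (card (S Q' i)) * real (card (S R' (k - i))))"
      by simp
    then have "fps_nth (tree_gf P) (Suc k) = fps_nth (tree_gf Q * tree_gf R + tree_gf Q' * tree_gf R') k"
      by (simp add: tree_gf_def S_def fps_mult_nth sum.distrib)
    then show ?thesis unfolding Suc by simp
  qed
qed

lemma tree_gf_False: "tree_gf (\<lambda>_. False) = 0"
  by (rule fps_ext) (simp add: tree_gf_def)

lemma tree_gf_Lf_disj:
  assumes "\<not> R Lf"
  shows "tree_gf (\<lambda>t. t = Lf \<or> R t) = 1 + tree_gf R"
proof (rule fps_ext)
  fix m
  have "{t. nodes t = m \<and> (t = Lf \<or> R t)}
      = (if m = 0 then {Lf} else {}) \<union> {t. nodes t = m \<and> R t}"
    by (auto split: if_splits)
  moreover have "card ((if m = 0 then {Lf} else {}) \<union> {t. nodes t = m \<and> R t})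
      = card (if m = 0 then {Lf} else {}) + card {t. nodes t = m \<and> R t}"
    using assms finite_nodes by (intro card_Un_disjoint) auto
  ultimately show "fps_nth (tree_gf (\<lambda>t. t = Lf \<or> R t)) m = fps_nth (1 + tree_gf R) m"
    by (simp add: tree_gf_def)
qed

text \<open>The last letter read is a down step, and \<open>QB\<close> is entered only by up
  steps.\<close>

lemma run_not_B: "run (Nd u v) q \<noteq> QB"
  by (cases "run v (step (run u q) True)") auto

lemma run_A_not_B: "run t QA \<noteq> QB"
  using run_not_B by (cases t) auto

lemma run_B_eq_B: "run t QB = QB \<longleftrightarrow> t = Lf"
  using run_not_B by (cases t) auto

text \<open>An up step kills \<open>QC\<close>, and \<open>QB\<close> never follows a balanced word
  read from \<open>QA\<close>; so the up step after \<open>u\<close> must lead to \<open>QB\<close>.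
  The sets {\<open>QA\<close>, \<open>QE\<close>} and {\<open>QA\<close>, \<open>QC\<close>}
  reproduce each other here and in \<open>run_Nd_B\<close>, which keeps the system at four series
  besides that of \<open>good\<close>.\<close>

lemma run_Nd_A:
  "run (Nd u v) QA \<in> {QA, QE} \<longleftrightarrow> run u QA \<in> {QA, QE} \<and> run v QB \<in> {QA, QC}"
  "run (Nd u v) QA \<in> {QA, QC} \<longleftrightarrow> run u QA \<in> {QA, QE} \<and> (v = Lf \<or> run v QB \<in> {QA, QE})"
  using run_A_not_B[of u] run_B_eq_B[of v]
  by (cases "run u QA"; cases "run v QB"; simp)+

lemma run_Nd_B:
  "run (Nd u v) QB \<in> {QA, QE} \<longleftrightarrow>
     u = Lf \<and> run v QA \<in> {QA, QC} \<or> run u QB \<in> {QA, QE} \<and> run v QB \<in> {QA, QC}"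
  "run (Nd u v) QB \<in> {QA, QC} \<longleftrightarrow>
     u = Lf \<and> run v QA \<in> {QA, QE} \<or> run u QB \<in> {QA, QE} \<and> (v = Lf \<or> run v QB \<in> {QA, QE})"
  unfolding run_B_eq_B[symmetric] using run_A_not_B[of v]
  by (cases "run u QB"; cases "run v QA"; cases "run v QB"; simp add: run_B_eq_B)+

text \<open>\<open>Q\<close> makes both square roots visible: its quadratic has discriminant (1 - 2
  X)^2 - 4 X^3, the inner radicand, and (2 G - 1)^2 = 1 + 4 X Q leads to the outer one. The
  elimination rests on the coincidences T = X W F and 1 + T = W = G.\<close>

lemma tree_gf_good:
  fixes G :: "real fps"
  defines "G \<equiv> tree_gf good"
  obtains Q where "G ^ 2 - G = fps_X * Q" "Q = 1 + 2 * fps_X * Q + fps_X ^ 3 * Q ^ 2"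
proof -
  define F where "F = tree_gf (\<lambda>t. run t QA \<in> {QA, QE})"
  define S where "S = tree_gf (\<lambda>t. run t QB \<in> {QA, QC})"
  define T where "T = tree_gf (\<lambda>t. run t QB \<in> {QA, QE})"
  define W where "W = tree_gf (\<lambda>t. run t QA \<in> {QA, QC})"
  have Lf1: "tree_gf (\<lambda>t. t = Lf) = 1"
    using tree_gf_Lf_disj[of "\<lambda>_. False"] by (simp add: tree_gf_False)
  have T1: "tree_gf (\<lambda>t. t = Lf \<or> run t QB \<in> {QA, QE}) = 1 + T"
    unfolding T_def by (rule tree_gf_Lf_disj) simp
  have nodisj: "\<not> (u = Lf \<and> run u QB \<in> {QA, QE})" for u by auto
  have F: "F = 1 + fps_X * (F * S)"
    using tree_gf_Nd[of "\<lambda>t. run t QA \<in> {QA, QE}" "\<lambda>t. run t QA \<in> {QA, QE}"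
        "\<lambda>t. run t QB \<in> {QA, QC}" "\<lambda>_. False" "\<lambda>_. False"] run_Nd_A(1)
    unfolding F_def S_def tree_gf_False by simp
  have S: "S = fps_X * (F + T * (1 + T))"
    using tree_gf_Nd[of "\<lambda>t. run t QB \<in> {QA, QC}" "\<lambda>t. t = Lf" "\<lambda>t. run t QA \<in> {QA, QE}"
        "\<lambda>t. run t QB \<in> {QA, QE}" "\<lambda>t. t = Lf \<or> run t QB \<in> {QA, QE}", OF run_Nd_B(2) nodisj]
    unfolding S_def[symmetric] F_def[symmetric] T1 T_def[symmetric] Lf1 by simp
  have T: "T = fps_X * (W + T * S)"
    using tree_gf_Nd[of "\<lambda>t. run t QB \<in> {QA, QE}" "\<lambda>t. t = Lf" "\<lambda>t. run t QA \<in> {QA, QC}"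
        "\<lambda>t. run t QB \<in> {QA, QE}" "\<lambda>t. run t QB \<in> {QA, QC}", OF run_Nd_B(1) nodisj]
    unfolding S_def[symmetric] W_def[symmetric] T_def[symmetric] Lf1 by simp
  have W: "W = 1 + fps_X * (F * (1 + T))"
    using tree_gf_Nd[of "\<lambda>t. run t QA \<in> {QA, QC}" "\<lambda>t. run t QA \<in> {QA, QE}"
        "\<lambda>t. t = Lf \<or> run t QB \<in> {QA, QE}" "\<lambda>_. False" "\<lambda>_. False"] run_Nd_A(2)
    unfolding F_def W_def T1 tree_gf_False by simp
  have "G = 1 + fps_X * (G * F + tree_gf (\<lambda>_. False) * tree_gf (\<lambda>_. False))"
    unfolding F_def G_def
    by (subst tree_gf_Nd[where Q = good and R = "\<lambda>t. run t QA \<in> {QA, QE}" and Q' = "\<lambda>_. False"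
      and R' = "\<lambda>_. False"]) auto
  then have G: "G = 1 + fps_X * (G * F)" by (simp add: tree_gf_False)
  \<comment> \<open>Cancels factors with constant term 1; this is how two series satisfying the same
    linear recursion are identified.\<close>
  have unit: "D = 0" if "D * (1 + fps_X * H) = 0" for D H :: "real fps"
  proof -
    have "fps_nth (1 + fps_X * H) 0 \<noteq> 0" by simp
    then have "1 + fps_X * H \<noteq> 0" by (metis fps_zero_nth)
    then show ?thesis using that by simp
  qed
  have "(1 - fps_X * S) * T = fps_X * W" "(1 - fps_X * S) * F = 1"
    using F T by (simp_all add: algebra_simps)
  then have "T = fps_X * W * F" by algebra
  then have "(1 + T - W) * (1 + fps_X * F) = 0" using W by algebra
  then have TW: "1 + T = W" using unit[of "1 + T - W" F] by simp
  have "(W - G) * (1 + fps_X * (- F)) = 0" using W G TW by (algebra)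
  then have WG: "W = G" using unit[of "W - G" "- F"] by simp
  define Q where "Q = F * G ^ 2"
  have "G ^ 2 - G = fps_X * Q" using G unfolding Q_def by algebra
  \<comment> \<open>Multiplication by \<open>(1 - fps_X * F) ^ 2\<close> turns \<open>Q\<close> into
    \<open>F\<close>, as \<open>G\<close> is the inverse of \<open>1 - fps_X * F\<close>; the claim
    becomes the equation of \<open>F\<close>.\<close>
  moreover have "(Q - (1 + 2 * fps_X * Q + fps_X ^ 3 * Q ^ 2)) * ((1 - fps_X * F) ^ 2) = 0"
  proof -
    have g: "G * (1 - fps_X * F) = 1" using G by (simp add: algebra_simps)
    have Sq: "S = fps_X * F + fps_X ^ 2 * Q"
      using S TW WG \<open>T = fps_X * W * F\<close> unfolding Q_def by algebra
    have Qp: "Q * (1 - fps_X * F) ^ 2 = F" using g unfolding Q_def by algebra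
    have "(Q - (1 + 2 * x * Q + x ^ 3 * Q ^ 2)) * p = Q * p - p - 2 * x * (Q * p) - x ^ 3 * Q * (Q * p)"
      for x p by (simp add: algebra_simps power2_eq_square)
    note this[of fps_X "(1 - fps_X * F) ^ 2", unfolded Qp]
    also have "F - (1 - fps_X * F) ^ 2 - 2 * fps_X * F - fps_X ^ 3 * Q * F
        = F - (1 + fps_X * (F * (fps_X * F + fps_X ^ 2 * Q)))"
      by (simp add: algebra_simps power2_eq_square power3_eq_cube)
    also have "\<dots> = 0" using F unfolding Sq by simp
    finally show ?thesis .
  qed
  then have "Q = 1 + 2 * fps_X * Q + fps_X ^ 3 * Q ^ 2"
    using unit[of "Q - (1 + 2 * fps_X * Q + fps_X ^ 3 * Q ^ 2)" "- 2 * F + fps_X * F ^ 2"]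
    by (simp add: power2_eq_square algebra_simps)
  ultimately show thesis using that by blast
qed

lemma fps_sqrt_eqI:
  assumes "g ^ 2 = f" "0 < fps_nth g 0"
  shows "fps_sqrt f = g"
proof (rule fps_sqrt_unique)
  have "subdegree g = 0" using assms(2) by (intro subdegree_eq_0) simp
  then show "0 \<le> fps_nth g (subdegree g)" using assms(2) by simp
qed (fact assms(1))

text \<open>The quadratic of \<open>Q\<close> gives s = 1 - 2 X - 2 X^3 Q, the branch with constant
  term 1. The outer root has order 1, and the single empty tree gives it leading coefficient 2 - 1 =
  1, which selects its sign.\<close>

lemma tree_gf_good_closed_form:
  fixes G s :: "real fps"
  defines "G \<equiv> tree_gf good"
  defines "s \<equiv> fps_sqrt (1 - 4 * fps_X + 4 * fps_X ^ 2 - 4 * fps_X ^ 3)"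
  shows "s ^ 2 = 1 - 4 * fps_X + 4 * fps_X ^ 2 - 4 * fps_X ^ 3" "fps_nth s 0 = 1"
    "(fps_X * (2 * G - 1)) ^ 2 = fps_X ^ 2 - 4 * fps_X + 2 - 2 * s"
    "fps_sqrt (fps_X ^ 2 - 4 * fps_X + 2 - 2 * s) = fps_X * (2 * G - 1)"
    "fps_nth G 0 = 1" "fps_nth G 1 = 1"
proof -
  obtain Q where Q: "G ^ 2 - G = fps_X * Q" "Q = 1 + 2 * fps_X * Q + fps_X ^ 3 * Q ^ 2"
    using tree_gf_good unfolding G_def by blast
  have s: "s = 1 - 2 * fps_X - 2 * fps_X ^ 3 * Q"
    unfolding s_def
  proof (rule fps_sqrt_eqI)
    show "(1 - 2 * fps_X - 2 * fps_X ^ 3 * Q) ^ 2 = 1 - 4 * fps_X + 4 * fps_X ^ 2 - 4 * fps_X ^ 3"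
      using Q(2) by algebra
  qed simp
  show "s ^ 2 = 1 - 4 * fps_X + 4 * fps_X ^ 2 - 4 * fps_X ^ 3"
    unfolding s using Q(2) by algebra
  show "fps_nth s 0 = 1" unfolding s by simp
  show sq: "(fps_X * (2 * G - 1)) ^ 2 = fps_X ^ 2 - 4 * fps_X + 2 - 2 * s"
    unfolding s using Q(1) by algebra
  have z: "nodes t = 0 \<longleftrightarrow> t = Lf" for t by (cases t) auto
  have o: "nodes t = 1 \<longleftrightarrow> t = Nd Lf Lf" for t by (cases t) (auto simp: z)
  have "{t. nodes t = 0 \<and> good t} = {Lf}" "{t. nodes t = 1 \<and> good t} = {Nd Lf Lf}"
    by (auto simp: z o[simplified])
  then show G01: "fps_nth G 0 = 1" "fps_nth G 1 = 1" by (simp_all add: G_def tree_gf_def)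
  show "fps_sqrt (fps_X ^ 2 - 4 * fps_X + 2 - 2 * s) = fps_X * (2 * G - 1)"
  proof (rule fps_sqrt_unique[OF sq])
    have "subdegree (fps_X * (2 * G - 1)) = 1"
      using G01 by (intro subdegreeI) (auto simp: fps_numeral_nth numeral_fps_const)
    then show "0 \<le> fps_nth (fps_X * (2 * G - 1)) (subdegree (fps_X * (2 * G - 1)))"
      using G01 by (simp add: numeral_fps_const)
  qed
qed

lemma Eeta_wins_gf:
  "Abs_fps (\<lambda>n. if n \<ge> 1 then real (card (Eeta_wins (order_ideals (A_root_poset n)))) else 0)
      = (- 1 - 2 * fps_X
         + fps_sqrt (fps_X ^ 2 - 4 * fps_X + 2
             - 2 * fps_sqrt (1 - 4 * fps_X + 4 * fps_X ^ 2 - 4 * fps_X ^ 3)) / fps_X)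
        / (2 * fps_X)" (is "?L = _")
proof -
  define G where "G = tree_gf good"
  \<comment> \<open>The wins for \<open>n\<close> are counted by trees with \<open>n + 1\<close>
    nodes; the trees with 0 and 1 nodes lie outside the range n >= 1.\<close>
  have L: "fps_X * ?L = G - 1 - fps_X"
  proof (rule fps_ext)
    fix m
    show "fps_nth (fps_X * ?L) m = fps_nth (G - 1 - fps_X) m"
      using tree_gf_good_closed_form(5,6) card_Eeta_wins_eq_tree_gf[of "m - 1"]
      by (cases m; cases "m - 1") (auto simp: G_def[symmetric] fps_X_nth)
  qed
  have "fps_X * (2 * G - 1) / fps_X = 2 * G - 1"
    by (metis fps_X_neq_zero nonzero_mult_div_cancel_left)
  moreover have "- 1 - 2 * fps_X + (2 * G - 1) = ?L * (2 * fps_X)"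
    using L by algebra
  moreover have "?L * (2 * fps_X) / (2 * fps_X) = ?L"
    by (rule nonzero_mult_div_cancel_right) simp
  ultimately show ?thesis
    unfolding tree_gf_good_closed_form(4) G_def[symmetric] by simp
qed


section \<open>Absolutely convergent power series\<close>

text \<open>A weighted l1 norm cut off at \<open>N\<close>. Finite sums need no convergence, are
  still submultiplicative, and allow induction on \<open>N\<close> as in
  \<open>norm_bound_sqrt\<close>.\<close>

definition partial_norm :: "real \<Rightarrow> nat \<Rightarrow> real fps \<Rightarrow> real" where
  "partial_norm r N f = (\<Sum>n\<le>N. \<bar>fps_nth f n\<bar> * r ^ n)"

definition norm_bound :: "real \<Rightarrow> real fps \<Rightarrow> real \<Rightarrow> bool" where
  "norm_bound r f M \<longleftrightarrow> (\<forall>N. partial_norm r N f \<le> M)"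

definition fps_value :: "real fps \<Rightarrow> real \<Rightarrow> real" where
  "fps_value f x = (\<Sum>n. fps_nth f n * x ^ n)"

lemma partial_norm_nonneg: "0 \<le> r \<Longrightarrow> 0 \<le> partial_norm r N f"
  by (auto simp: partial_norm_def intro!: sum_nonneg)

lemma partial_norm_add:
  assumes "0 \<le> r"
  shows "partial_norm r N (f + g) \<le> partial_norm r N f + partial_norm r N g"
  unfolding partial_norm_def sum.distrib[symmetric]
  using assms by (intro sum_mono) (auto simp: distrib_right[symmetric] intro!: mult_right_mono)

lemma partial_norm_uminus [simp]: "partial_norm r N (- f) = partial_norm r N f"
  by (simp add: partial_norm_def)

lemma partial_norm_diff:
  assumes "0 \<le> r"
  shows "partial_norm r N (f - g) \<le> partial_norm r N f + partial_norm r N g"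
  using partial_norm_add[OF assms, of N f "- g"] by simp

lemma partial_norm_mult:
  assumes "0 \<le> r"
  shows "partial_norm r N (f * g) \<le> partial_norm r N f * partial_norm r N g"
proof -
  let ?a = "\<lambda>i. \<bar>fps_nth f i\<bar> * r ^ i" and ?b = "\<lambda>i. \<bar>fps_nth g i\<bar> * r ^ i"
  have "partial_norm r N (f * g) \<le> (\<Sum>n\<le>N. \<Sum>i\<le>n. ?a i * ?b (n - i))"
    unfolding partial_norm_def
  proof (rule sum_mono)
    fix n
    have "\<bar>fps_nth (f * g) n\<bar> * r ^ n \<le> (\<Sum>i\<le>n. \<bar>fps_nth f i * fps_nth g (n - i)\<bar>) * r ^ n"
      using assms unfolding fps_mult_nth atMost_atLeast0 by (intro mult_right_mono sum_abs) auto
    also have "\<dots> = (\<Sum>i\<le>n. ?a i * ?b (n - i))"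
      unfolding sum_distrib_right
      by (intro sum.cong refl) (simp add: abs_mult power_add[symmetric])
    finally show "\<bar>fps_nth (f * g) n\<bar> * r ^ n \<le> (\<Sum>i\<le>n. ?a i * ?b (n - i))" .
  qed
  also have "\<dots> = (\<Sum>(i, j)\<in>{(i, j). i + j \<le> N}. ?a i * ?b j)"
    by (rule sum.triangle_reindex_eq[symmetric])
  also have "\<dots> \<le> (\<Sum>(i, j)\<in>{..N} \<times> {..N}. ?a i * ?b j)"
    using assms by (intro sum_mono2) auto
  also have "\<dots> = partial_norm r N f * partial_norm r N g"
    by (simp add: partial_norm_def sum_product sum.cartesian_product)
  finally show ?thesis .
qed

lemma norm_bound_add:
  "0 \<le> r \<Longrightarrow> norm_bound r f a \<Longrightarrow> norm_bound r g b \<Longrightarrow> norm_bound r (f + g) (a + b)"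
  unfolding norm_bound_def using partial_norm_add by (meson add_mono order_trans)

lemma norm_bound_diff:
  "0 \<le> r \<Longrightarrow> norm_bound r f a \<Longrightarrow> norm_bound r g b \<Longrightarrow> norm_bound r (f - g) (a + b)"
  unfolding norm_bound_def using partial_norm_diff by (meson add_mono order_trans)

lemma norm_bound_mult:
  assumes "0 \<le> r" "norm_bound r f a" "norm_bound r g b"
  shows "norm_bound r (f * g) (a * b)"
  unfolding norm_bound_def
proof
  fix N
  have "partial_norm r N (f * g) \<le> partial_norm r N f * partial_norm r N g"
    by (rule partial_norm_mult[OF assms(1)])
  also have "\<dots> \<le> a * b"
    using assms partial_norm_nonneg[OF assms(1)] by (intro mult_mono') (auto simp: norm_bound_def)
  finally show "partial_norm r N (f * g) \<le> a * b" .
qed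

lemma norm_bound_mono: "norm_bound r f a \<Longrightarrow> a \<le> b \<Longrightarrow> norm_bound r f b"
  unfolding norm_bound_def by (meson order_trans)

lemma norm_bound_const: "norm_bound r (fps_const c) \<bar>c\<bar>"
proof -
  have "partial_norm r N (fps_const c) = (\<Sum>n\<le>N. if n = 0 then \<bar>c\<bar> else 0)" for N
    unfolding partial_norm_def by (intro sum.cong) auto
  then show ?thesis unfolding norm_bound_def by simp
qed

lemma norm_bound_X: "0 \<le> r \<Longrightarrow> norm_bound r fps_X r"
proof -
  assume r: "0 \<le> r"
  have "partial_norm r N fps_X = (\<Sum>n\<le>N. if n = 1 then r else 0)" for N
    unfolding partial_norm_def by (intro sum.cong) (auto simp: fps_X_nth)
  then show ?thesis unfolding norm_bound_def using r by simp
qed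

text \<open>
  The square root of \<open>1 + g\<close> is \<open>1 + h\<close> with \<open>2 h = g - h\<^sup>2\<close>, so the norms of the truncations of
  \<open>h\<close> stay below any solution \<open>y\<close> of \<open>a + y\<^sup>2 \<le> 2 y\<close>.
\<close>

lemma norm_bound_sqrt:
  assumes r: "0 \<le> r" and g: "norm_bound r g a" and h: "(1 + h) ^ 2 = 1 + g" "fps_nth h 0 = 0"
    and y: "0 \<le> y" "a + y ^ 2 \<le> 2 * y"
  shows "norm_bound r h y"
  unfolding norm_bound_def
proof
  fix N
  show "partial_norm r N h \<le> y"
  proof (induction N)
    case 0
    then show ?case using h y by (simp add: partial_norm_def)
  next
    case (Suc M)
    define t where "t = Abs_fps (\<lambda>n. if n \<le> M then fps_nth h n else 0)"
    have t: "partial_norm r (Suc M) t = partial_norm r M h"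
    proof -
      have "partial_norm r (Suc M) t = partial_norm r M t"
        by (simp add: partial_norm_def t_def)
      also have "\<dots> = partial_norm r M h"
        unfolding partial_norm_def by (intro sum.cong) (auto simp: t_def)
      finally show ?thesis .
    qed
    \<comment> \<open>\<open>h\<close> has no constant term, so the coefficients of its square up to
      \<open>Suc M\<close> involve those of \<open>h\<close> only up to \<open>M\<close>.\<close>
    have hh: "fps_nth (h * h) n = fps_nth (t * t) n" if n: "n \<le> Suc M" for n
      unfolding fps_mult_nth
    proof (rule sum.cong[OF refl])
      fix i assume i: "i \<in> {0..n}"
      consider "i = 0" | "n - i = 0" | "i \<le> M" "n - i \<le> M"
        using i n by force
      then show "fps_nth h i * fps_nth h (n - i) = fps_nth t i * fps_nth t (n - i)"
        by cases (use h i in \<open>auto simp: t_def\<close>)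
    qed
    have "partial_norm r (Suc M) (h * h) = partial_norm r (Suc M) (t * t)"
      unfolding partial_norm_def by (intro sum.cong) (auto simp: hh)
    also have "\<dots> \<le> partial_norm r M h * partial_norm r M h"
      using partial_norm_mult[OF r, of "Suc M" t t] by (simp add: t)
    also have "\<dots> \<le> y * y"
      using Suc partial_norm_nonneg[OF r] y by (intro mult_mono) auto
    finally have hy: "partial_norm r (Suc M) (h * h) \<le> y ^ 2" by (simp add: power2_eq_square)
    have "2 * partial_norm r (Suc M) h = partial_norm r (Suc M) (2 * h)"
      by (simp add: partial_norm_def numeral_fps_const sum_distrib_left abs_mult mult.assoc)
    also have "2 * h = g - h * h"
      using h by (simp add: algebra_simps power2_eq_square)
    also have "partial_norm r (Suc M) \<dots> \<le> partial_norm r (Suc M) g + partial_norm r (Suc M) (h * h)"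
      by (rule partial_norm_diff[OF r])
    also have "\<dots> \<le> a + y ^ 2" using g hy by (intro add_mono) (auto simp: norm_bound_def)
    also have "\<dots> \<le> 2 * y" by fact
    finally show ?case by simp
  qed
qed

text \<open>From f = 1 - f h the truncated norm t of \<open>f\<close> satisfies t <= 1 + t y, and a
  finite t can be isolated.\<close>

lemma norm_bound_inverse:
  assumes r: "0 \<le> r" and h: "norm_bound r h y" "y < 1" and f: "f * (1 + h) = 1"
  shows "norm_bound r f (1 / (1 - y))"
  unfolding norm_bound_def
proof
  fix N
  have "f = fps_const 1 - f * h" using f by (simp add: algebra_simps)
  then have "partial_norm r N f = partial_norm r N (fps_const 1 - f * h)" by simp
  also have "\<dots> \<le> partial_norm r N (fps_const 1) + partial_norm r N (f * h)"
    by (rule partial_norm_diff[OF r])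
  also have "\<dots> \<le> 1 + partial_norm r N f * y"
  proof (rule add_mono)
    show "partial_norm r N (fps_const 1) \<le> 1"
      using norm_bound_const[of r 1] by (simp add: norm_bound_def)
    have "partial_norm r N (f * h) \<le> partial_norm r N f * partial_norm r N h"
      by (rule partial_norm_mult[OF r])
    also have "\<dots> \<le> partial_norm r N f * y"
      using h partial_norm_nonneg[OF r] by (intro mult_left_mono) (auto simp: norm_bound_def)
    finally show "partial_norm r N (f * h) \<le> partial_norm r N f * y" .
  qed
  finally have "partial_norm r N f * (1 - y) \<le> 1" by (simp add: algebra_simps)
  then show "partial_norm r N f \<le> 1 / (1 - y)" using h(2) by (simp add: field_simps)
qed

lemma norm_bound_nth:
  assumes "0 \<le> r" "norm_bound r f a"
  shows "\<bar>fps_nth f n\<bar> * r ^ n \<le> a"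
proof -
  have "\<bar>fps_nth f n\<bar> * r ^ n \<le> partial_norm r n f"
    unfolding partial_norm_def using assms(1)
    by (intro member_le_sum) auto
  then show ?thesis using assms(2) unfolding norm_bound_def by (meson order_trans)
qed

lemma norm_bound_summable:
  assumes r: "0 \<le> r" and f: "norm_bound r f a" and x: "\<bar>x\<bar> \<le> r"
  shows "summable (\<lambda>n. norm (fps_nth f n * x ^ n))"
proof (rule summable_comparison_test')
  show "summable (\<lambda>n. \<bar>fps_nth f n\<bar> * r ^ n)"
  proof (rule bounded_imp_summable)
    show "(\<Sum>k\<le>n. \<bar>fps_nth f k\<bar> * r ^ k) \<le> a" for n
      using f by (auto simp: norm_bound_def partial_norm_def)
  qed (use r in auto)
  show "norm (norm (fps_nth f n * x ^ n)) \<le> \<bar>fps_nth f n\<bar> * r ^ n" if "n \<ge> 0" for n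
    using x by (auto simp: abs_mult power_abs intro!: mult_left_mono power_mono)
qed

lemma fps_value_mult:
  assumes "0 \<le> r" "norm_bound r f a" "norm_bound r g b" "\<bar>x\<bar> \<le> r"
  shows "fps_value (f * g) x = fps_value f x * fps_value g x"
proof -
  have "fps_nth (f * g) n * x ^ n = (\<Sum>i\<le>n. (fps_nth f i * x ^ i) * (fps_nth g (n - i) * x ^ (n - i)))" for n
    unfolding fps_mult_nth atMost_atLeast0 sum_distrib_right
    by (intro sum.cong refl) (simp add: power_add[symmetric])
  then show ?thesis
    unfolding fps_value_def
    using Cauchy_product[OF norm_bound_summable[OF assms(1,2,4)] norm_bound_summable[OF assms(1,3,4)]]
    by simp
qed

lemma fps_value_add:
  assumes "0 \<le> r" "norm_bound r f a" "norm_bound r g b" "\<bar>x\<bar> \<le> r"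
  shows "fps_value (f + g) x = fps_value f x + fps_value g x"
  unfolding fps_value_def
  using suminf_add[OF summable_norm_cancel[OF norm_bound_summable[OF assms(1,2,4)]]
      summable_norm_cancel[OF norm_bound_summable[OF assms(1,3,4)]]]
  by (simp add: algebra_simps)

lemma fps_value_const: "fps_value (fps_const c) x = c"
proof -
  have "(\<lambda>n. fps_nth (fps_const c) n * x ^ n) = (\<lambda>n. if n = 0 then c else 0)" by auto
  then show ?thesis unfolding fps_value_def using sums_unique[OF sums_single[of 0 "\<lambda>_. c"]] by simp
qed

lemma fps_value_X: "fps_value fps_X x = x"
proof -
  have "(\<lambda>n. fps_nth fps_X n * x ^ n) = (\<lambda>n. if n = 1 then x else 0)" by (auto simp: fps_X_nth)
  then show ?thesis unfolding fps_value_def using sums_unique[OF sums_single[of 1 "\<lambda>_. x"]] by simp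
qed

lemma abs_fps_value_le:
  assumes "0 \<le> r" "norm_bound r f a" "\<bar>x\<bar> \<le> r"
  shows "\<bar>fps_value f x\<bar> \<le> a"
proof -
  have s: "summable (\<lambda>n. norm (fps_nth f n * x ^ n))" by (rule norm_bound_summable[OF assms])
  have "norm (fps_value f x) \<le> (\<Sum>n. norm (fps_nth f n * x ^ n))"
    unfolding fps_value_def by (rule summable_norm[OF s])
  also have "\<dots> \<le> a"
  proof (rule suminf_le_const[OF s])
    fix N
    have "(\<Sum>n<N. norm (fps_nth f n * x ^ n)) \<le> (\<Sum>n\<le>N. \<bar>fps_nth f n\<bar> * r ^ n)"
    proof (rule order_trans)
      show "(\<Sum>n<N. norm (fps_nth f n * x ^ n)) \<le> (\<Sum>n<N. \<bar>fps_nth f n\<bar> * r ^ n)"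
        using assms by (intro sum_mono) (auto simp: abs_mult power_abs intro!: mult_left_mono power_mono)
      show "(\<Sum>n<N. \<bar>fps_nth f n\<bar> * r ^ n) \<le> (\<Sum>n\<le>N. \<bar>fps_nth f n\<bar> * r ^ n)"
        using assms by (intro sum_mono2) auto
    qed
    then show "(\<Sum>n<N. norm (fps_nth f n * x ^ n)) \<le> a"
      using assms(2) unfolding norm_bound_def partial_norm_def by (meson order_trans)
  qed
  finally show ?thesis by simp
qed

section \<open>Coefficients at a square root singularity\<close>

lemma Gamma_minus_half: "Gamma (- (1 / 2) :: real) = - 2 * sqrt pi"
proof -
  have "(- 1 / 2 :: real) \<notin> \<int>"
  proof
    assume "(- 1 / 2 :: real) \<in> \<int>"
    then obtain k :: int where "(- 1 / 2 :: real) = of_int k" by (auto elim: Ints_cases)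
    then have "(- 1 :: real) = of_int (2 * k)" by simp
    then have "- 1 = 2 * k" by linarith
    then show False by presburger
  qed
  then have "(- 1 / 2 :: real) \<notin> \<int>\<^sub>\<le>\<^sub>0" using nonpos_Ints_subset_Ints by blast
  from Gamma_plus1[OF this] show ?thesis by (simp add: Gamma_one_half_real)
qed

text \<open>The limit is 1 / Gamma(-1/2). The base \<open>real n + 1\<close> makes the weight
  nonzero at \<open>n = 0\<close>, where the convolution in
  \<open>sqrt_linear_mult_asymptotics\<close> divides by it.\<close>

lemma gbinomial_half_limit:
  "(\<lambda>n. ((1 / 2 :: real) gchoose n) * (- 1) ^ n * (real n + 1) powr (3 / 2)) \<longlonglongrightarrow> - 1 / (2 * sqrt pi)"
proof -
  have lim: "(\<lambda>n. (((1 / 2 :: real) gchoose n) / ((- 1) ^ n / exp ((1 / 2 + 1) * of_real (ln (real n)))))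
      * ((real n + 1) / real n) powr (3 / 2)) \<longlonglongrightarrow> inverse (Gamma (- (1 / 2))) * 1"
  proof (intro tendsto_mult)
    show "(\<lambda>n. ((real n + 1) / real n) powr (3 / 2)) \<longlonglongrightarrow> 1" by real_asymp
  qed (use gbinomial_asymptotic[of "1 / 2 :: real"] in simp)
  have ev: "eventually (\<lambda>n. (((1 / 2 :: real) gchoose n) / ((- 1) ^ n / exp ((1 / 2 + 1) * of_real (ln (real n)))))
      * ((real n + 1) / real n) powr (3 / 2)
      = ((1 / 2 :: real) gchoose n) * (- 1) ^ n * (real n + 1) powr (3 / 2)) sequentially"
    using eventually_gt_at_top[of 0]
  proof eventually_elim
    case (elim n)
    have e: "exp ((1 / 2 + 1) * of_real (ln (real n))) = real n powr (3 / 2)"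
      using elim by (simp add: powr_def)
    have p: "((real n + 1) / real n) powr (3 / 2) = (real n + 1) powr (3 / 2) / real n powr (3 / 2)"
      by (simp add: powr_divide)
    have i: "inverse ((- 1 :: real) ^ n) = (- 1) ^ n" by (simp add: minus_one_power_iff)
    have gen: "b / (s / P) * (Q / P) = b * inverse s * Q" if "P > 0" for b s P Q :: real
      using that by (simp add: divide_inverse)
    show ?case unfolding e p by (subst gen) (use elim i in auto)
  qed
  have "inverse (Gamma (- (1 / 2) :: real)) * 1 = - 1 / (2 * sqrt pi)"
    by (simp add: Gamma_minus_half divide_simps)
  with Lim_transform_eventually[OF lim ev] show ?thesis by (simp only:)
qed

definition sqrt_linear :: "real \<Rightarrow> real fps" where
  "sqrt_linear c = Abs_fps (\<lambda>n. ((1 / 2) gchoose n) * (- c) ^ n)"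

lemma sqrt_linear_square: "sqrt_linear c ^ 2 = 1 - fps_const c * fps_X"
proof -
  have eq: "sqrt_linear c = fps_binomial (1 / 2) oo (fps_const (- c) * fps_X)"
    by (rule fps_ext) (simp add: sqrt_linear_def)
  have "sqrt_linear c ^ 2 = (fps_binomial (1 / 2) ^ 2) oo (fps_const (- c) * fps_X)"
    unfolding eq by (rule fps_compose_power) simp
  also have "fps_binomial (1 / 2 :: real) ^ 2 = 1 + fps_X"
    by (simp add: fps_binomial_power fps_binomial_1)
  also have "(1 + fps_X) oo (fps_const (- c) * fps_X) = 1 - fps_const c * (fps_X :: real fps)"
    by (simp add: fps_compose_add_distrib)
  finally show ?thesis .
qed

lemma sqrt_linear_mult_asymptotics:
  assumes c: "0 < c" and r: "1 / c < r" and u: "norm_bound r u K"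
  shows "(\<lambda>N. fps_nth (sqrt_linear c * u) N * (real N + 1) powr (3 / 2) / c ^ N)
    \<longlonglongrightarrow> - 1 / (2 * sqrt pi) * fps_value u (1 / c)"
proof -
  define x where "x = (\<lambda>n. ((1 / 2 :: real) gchoose n) * (- 1) ^ n * (real n + 1) powr (3 / 2))"
  define L where "L = - 1 / (2 * sqrt pi)"
  have xL: "x \<longlonglongrightarrow> L" unfolding x_def L_def by (rule gbinomial_half_limit)
  then have "Bseq x" by (intro convergent_imp_Bseq convergentI)
  then obtain C where C: "0 < C" "\<And>n. norm (x n) \<le> C" by (auto simp: Bseq_def)
  \<comment> \<open>The coefficients of \<open>u\<close> are controlled at radius \<open>r\<close>
    but used at \<open>1 / c\<close>; the spare factor \<open>q ^ i\<close> absorbs the polynomial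
    growth, with bound \<open>D\<close>.\<close>
  define q where "q = 1 / (c * r)"
  have r0: "0 < r" using c r by (meson divide_pos_pos less_trans zero_less_one)
  have q: "0 < q" "q < 1" using c r r0 by (auto simp: q_def field_simps)
  have "(\<lambda>i. q ^ i * (real i + 1) ^ 2) \<longlonglongrightarrow> 0" using q by real_asymp
  then have "Bseq (\<lambda>i. q ^ i * (real i + 1) ^ 2)" by (intro convergent_imp_Bseq convergentI)
  then obtain D where D: "0 < D" "\<And>i. norm (q ^ i * (real i + 1) ^ 2) \<le> D"
    unfolding Bseq_def by blast
  \<comment> \<open>The normalised convolution terms, extended by 0 beyond \<open>N\<close>. The
    ratio appears because \<open>x (N - i)\<close> carries the weight belonging to
    \<open>N - i\<close> instead of \<open>N\<close>.\<close>
  define a where "a = (\<lambda>i N. if i \<le> N then fps_nth u i * (1 / c) ^ i * x (N - i)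
      * ((real N + 1) / (real (N - i) + 1)) powr (3 / 2) else 0)"
  define M where "M = (\<lambda>i. C * D * (norm (fps_nth u i * r ^ i)))"
  have lim: "(\<lambda>N. a i N) \<longlonglongrightarrow> fps_nth u i * (1 / c) ^ i * L" for i
  proof -
    have "(\<lambda>N. fps_nth u i * (1 / c) ^ i * x (N - i)
        * ((real N + 1) / (real N - real i + 1)) powr (3 / 2)) \<longlonglongrightarrow> fps_nth u i * (1 / c) ^ i * L * 1"
    proof (intro tendsto_mult tendsto_const)
      show "(\<lambda>N. x (N - i)) \<longlonglongrightarrow> L"
        using xL by (rule filterlim_compose) (rule filterlim_minus_const_nat_at_top)
      show "(\<lambda>N. ((real N + 1) / (real N - real i + 1)) powr (3 / 2)) \<longlonglongrightarrow> 1" by real_asymp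
    qed
    moreover have "eventually (\<lambda>N. fps_nth u i * (1 / c) ^ i * x (N - i)
        * ((real N + 1) / (real N - real i + 1)) powr (3 / 2) = a i N) sequentially"
      using eventually_ge_at_top[of i] by eventually_elim (simp add: a_def of_nat_diff)
    ultimately show ?thesis using Lim_transform_eventually by fastforce
  qed
  have bound: "norm (a i N) \<le> M i" for i N
  proof (cases "i \<le> N")
    case True
    have "(real N + 1) / (real (N - i) + 1) \<le> real i + 1"
    proof -
      \<comment> \<open>The two sides differ by i (N - i).\<close>
      have "real N + 1 \<le> (real i + 1) * (real (N - i) + 1)"
        using True mult_right_mono[of "real i" "real N" "real i"] by (simp add: algebra_simps of_nat_diff)
      then show ?thesis by (simp add: divide_le_eq)
    qed
    then have "((real N + 1) / (real (N - i) + 1)) powr (3 / 2) \<le> (real i + 1) powr (3 / 2)"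
      by (intro powr_mono2) auto
    also have "\<dots> \<le> (real i + 1) powr 2" by (intro powr_mono) auto
    also have "\<dots> = (real i + 1) ^ 2" by simp
    finally have p: "((real N + 1) / (real (N - i) + 1)) powr (3 / 2) \<le> (real i + 1) ^ 2" .
    have "norm (a i N) = norm (fps_nth u i) * (1 / c) ^ i * norm (x (N - i))
        * ((real N + 1) / (real (N - i) + 1)) powr (3 / 2)"
      using True c by (simp add: a_def abs_mult)
    also have "\<dots> \<le> norm (fps_nth u i) * (1 / c) ^ i * C * (real i + 1) ^ 2"
      using p C c by (intro mult_mono) auto
    also have "(1 / c) ^ i = q ^ i * r ^ i"
      using r0 c by (simp add: q_def power_mult_distrib[symmetric])
    also have "norm (fps_nth u i) * (q ^ i * r ^ i) * C * (real i + 1) ^ 2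
        = C * norm (fps_nth u i * r ^ i) * (q ^ i * (real i + 1) ^ 2)"
      using r0 by (simp add: abs_mult)
    also have "\<dots> \<le> C * norm (fps_nth u i * r ^ i) * D"
      using D(2)[of i] C q by (intro mult_left_mono) auto
    finally show ?thesis by (simp add: M_def mult_ac)
  next
    case False
    then show ?thesis using C D by (simp add: a_def M_def)
  qed
  have "summable M"
    unfolding M_def using norm_bound_summable[OF _ u, of r] r0 by (intro summable_mult) auto
  moreover have "eventually (\<lambda>(k, n). norm (a k n) \<le> M k) (at_top \<times>\<^sub>F sequentially)"
    using bound by (simp add: case_prod_unfold)
  ultimately have "(\<lambda>N. \<Sum>i. a i N) \<longlonglongrightarrow> (\<Sum>i. fps_nth u i * (1 / c) ^ i * L)"
    using tannerys_theorem[OF lim, where M = M] by simp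
  also have "(\<Sum>i. fps_nth u i * (1 / c) ^ i * L) = L * fps_value u (1 / c)"
  proof -
    have "summable (\<lambda>i. fps_nth u i * (1 / c) ^ i)"
      by (rule summable_norm_cancel[OF norm_bound_summable[OF _ u]]) (use r r0 c in auto)
    from suminf_mult[OF this, of L] show ?thesis by (simp add: fps_value_def mult_ac)
  qed
  finally have main: "(\<lambda>N. \<Sum>i. a i N) \<longlonglongrightarrow> L * fps_value u (1 / c)" .
  have "(\<Sum>i. a i N) = fps_nth (sqrt_linear c * u) N * (real N + 1) powr (3 / 2) / c ^ N" for N
  proof -
    have "(\<Sum>i. a i N) = (\<Sum>i\<le>N. a i N)"
      by (rule suminf_finite) (auto simp: a_def)
    also have "\<dots> = (\<Sum>i\<le>N. fps_nth u i * fps_nth (sqrt_linear c) (N - i) * ((real N + 1) powr (3 / 2) / c ^ N))"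
    proof (rule sum.cong[OF refl])
      fix i assume "i \<in> {..N}"
      then have i: "i \<le> N" by simp
      have "((real N + 1) / (real (N - i) + 1)) powr (3 / 2)
          = (real N + 1) powr (3 / 2) / (real (N - i) + 1) powr (3 / 2)"
        by (simp add: powr_divide)
      moreover have "c ^ N = c ^ i * c ^ (N - i)" using i by (simp add: power_add[symmetric])
      moreover have "(- c) ^ (N - i) = (- 1) ^ (N - i) * c ^ (N - i)"
        by (metis mult_minus1 power_mult_distrib)
      moreover have "(real (N - i) + 1) powr (3 / 2) \<noteq> 0" by simp
      ultimately show "a i N = fps_nth u i * fps_nth (sqrt_linear c) (N - i) * ((real N + 1) powr (3 / 2) / c ^ N)"
        using i c by (simp add: a_def x_def sqrt_linear_def power_divide field_simps del: powr_eq_0_iff)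
    qed
    also have "\<dots> = fps_nth (u * sqrt_linear c) N * ((real N + 1) powr (3 / 2) / c ^ N)"
      unfolding fps_mult_nth atMost_atLeast0 sum_distrib_right ..
    finally show ?thesis by (simp add: mult.commute)
  qed
  then show ?thesis using main unfolding L_def by simp
qed


section \<open>The constants\<close>

lemma cube_powr_third: "0 < a \<Longrightarrow> (a powr (1 / 3)) ^ 3 = (a :: real)"
proof -
  assume a: "0 < a"
  have "(a powr (1 / 3)) ^ 3 = a powr (1 / 3 * real 3)"
    using a by (subst powr_powr[symmetric]) (simp add: powr_realpow)
  then show ?thesis using a by simp
qed

lemma sqrt_57_bounds: "7.549 < sqrt 57" "sqrt 57 < 7.55"
  using real_less_rsqrt[of "7.549" 57] real_less_lsqrt[of "7.55" 57]
  by (simp_all add: power2_eq_square)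

text \<open>Cardano's formula: p = 6 x - 2 turns the cubic into p^3 + 24 p + 2 = 0, solved by p = y
  - z with y z = 8 and y^3 - z^3 = -2. The cube of z comes from (3 sqrt 57 - 1) (3 sqrt 57 + 1) =
  512.\<close>

lemma inverse_rho_cubic:
  fixes x :: real
  assumes "x = (2 - 8 * (3 * sqrt 57 - 1) powr (- 1 / 3) + (3 * sqrt 57 - 1) powr (1 / 3)) / 6"
  shows "4 * x ^ 3 - 4 * x ^ 2 + 4 * x - 1 = 0"
proof -
  define y where "y = (3 * sqrt 57 - 1) powr (1 / 3)"
  define z where "z = 8 * (3 * sqrt 57 - 1) powr (- 1 / 3)"
  have pos: "0 < 3 * sqrt 57 - 1" using sqrt_57_bounds by simp
  then have y0: "0 < y" by (simp add: y_def)
  have y3: "y ^ 3 = 3 * sqrt 57 - 1" unfolding y_def by (rule cube_powr_third[OF pos])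
  have "c powr (- 1 / 3) = 1 / c powr (1 / 3)" for c :: real
    using powr_minus_divide[of c "1 / 3"] by simp
  then have "z = 8 * (1 / y)" unfolding z_def y_def by (simp only:)
  then have yz: "y * z = 8" using y0 by simp
  then have "y ^ 3 * z ^ 3 = 512" by (simp add: power_mult_distrib[symmetric])
  then have "(3 * sqrt 57 - 1) * z ^ 3 = (3 * sqrt 57 - 1) * (3 * sqrt 57 + 1)"
    unfolding y3 by (simp add: algebra_simps)
  then have z3: "z ^ 3 = 3 * sqrt 57 + 1" using pos by simp
  define p where "p = y - z"
  have "p ^ 3 = y ^ 3 - z ^ 3 - 3 * (y * z) * p"
    by (simp add: p_def power3_eq_cube algebra_simps)
  then have p3: "p ^ 3 + 24 * p + 2 = 0" unfolding yz y3 z3 by simp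
  have "6 * x = 2 + p" using assms by (simp add: p_def y_def z_def)
  then have "p = 6 * x - 2" by simp
  with p3 show ?thesis by (simp add: power3_eq_cube power2_eq_square algebra_simps)
qed

text \<open>The difference quotient of the cubic is a positive sum of squares, so its sign at a
  rational point locates the root. The bracket is narrow enough for the decimals of both rho and
  gamma.\<close>

lemma inverse_rho_bounds:
  fixes x :: real
  assumes "4 * x ^ 3 - 4 * x ^ 2 + 4 * x - 1 = 0"
  shows "0.319448 < x" "x < 0.3194485"
proof -
  have diff: "4 * x ^ 3 - 4 * x ^ 2 + 4 * x - 1 - (4 * c ^ 3 - 4 * c ^ 2 + 4 * c - 1)
      = (x - c) * (2 * x ^ 2 + 2 * c ^ 2 + 2 * (x + c - 1) ^ 2 + 2)" for c :: real
    by (simp add: power3_eq_cube power2_eq_square algebra_simps)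
  have pos: "0 < 2 * x ^ 2 + 2 * c ^ 2 + 2 * (x + c - 1) ^ 2 + 2" for c :: real
    by (intro add_nonneg_pos add_nonneg_nonneg) auto
  have gt: "c < x" if "4 * c ^ 3 - 4 * c ^ 2 + 4 * c - 1 < 0" for c
  proof -
    have "0 < (x - c) * (2 * x ^ 2 + 2 * c ^ 2 + 2 * (x + c - 1) ^ 2 + 2)"
      using that assms unfolding diff[symmetric] by linarith
    from zero_less_mult_pos2[OF this pos] show ?thesis by simp
  qed
  have lt: "x < c" if "0 < 4 * c ^ 3 - 4 * c ^ 2 + 4 * c - 1" for c
  proof -
    have "(x - c) * (2 * x ^ 2 + 2 * c ^ 2 + 2 * (x + c - 1) ^ 2 + 2) < 0"
      using that assms unfolding diff[symmetric] by linarith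
    then have "0 < (c - x) * (2 * x ^ 2 + 2 * c ^ 2 + 2 * (x + c - 1) ^ 2 + 2)"
      unfolding left_diff_distrib by linarith
    from zero_less_mult_pos2[OF this pos] show ?thesis by simp
  qed
  show "0.319448 < x" by (rule gt) (simp add: power3_eq_cube power2_eq_square)
  show "x < 0.3194485" by (rule lt) (simp add: power3_eq_cube power2_eq_square)
qed

text \<open>
  The two cube roots have product 9676 and sum \<open>256 - 324 x + 444 x\<^sup>2\<close>, the only real root of
  \<open>q\<^sup>3 = 29028 q + 1997836\<close>.
\<close>

lemma gamma_square:
  fixes x \<gamma> :: real
  assumes x: "4 * x ^ 3 - 4 * x ^ 2 + 4 * x - 1 = 0"
    and gamma: "\<gamma> = 1 / (4 * sqrt 291) *
      sqrt (576 + (1726130304 - 69393024 * sqrt 57) powr (1 / 3)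
                + 12 * (998918 + 40158 * sqrt 57) powr (1 / 3))"
  shows "0 < \<gamma>" "\<gamma> ^ 2 = (76 - 81 * x + 111 * x ^ 2) / 97"
proof -
  define a where "a = (998918 - 40158 * sqrt 57) powr (1 / 3)"
  define b where "b = (998918 + 40158 * sqrt 57) powr (1 / 3)"
  have pos: "0 < 998918 - 40158 * sqrt 57" "0 < 998918 + 40158 * sqrt 57"
    using sqrt_57_bounds by simp_all
  have a3: "a ^ 3 = 998918 - 40158 * sqrt 57" and b3: "b ^ 3 = 998918 + 40158 * sqrt 57"
    using pos by (simp_all add: a_def b_def cube_powr_third)
  have ab0: "0 < a" "0 < b" using pos by (simp_all add: a_def b_def)
  have "(a * b) ^ 3 = 9676 ^ 3"
    unfolding power_mult_distrib a3 b3 by (simp add: algebra_simps)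
  then have ab: "a * b = 9676" using ab0 by (subst (asm) power_eq_iff_eq_base) auto
  define q where "q = a + b"
  have "q ^ 3 = a ^ 3 + b ^ 3 + 3 * (a * b) * q"
    by (simp add: q_def power3_eq_cube algebra_simps)
  then have q3: "q ^ 3 = 1997836 + 29028 * q" unfolding ab a3 b3 by simp
  have q0: "0 < q" using ab0 by (simp add: q_def)
  \<comment> \<open>197 exceeds sqrt (4 * 29028 / 3) = 196.7..., beyond which the quadratic cofactor
    of \<open>s - q\<close> has no real zero in \<open>s\<close>.\<close>
  have q197: "197 < q"
  proof (rule ccontr)
    assume "\<not> 197 < q"
    then have "q * q \<le> 197 * 197" using q0 by (intro mult_mono) auto
    then have "q * q - 29028 \<le> 9781" by simp
    then have "q * (q * q - 29028) \<le> q * 9781" using q0 by (intro mult_left_mono) auto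
    also have "\<dots> \<le> 197 * 9781" using \<open>\<not> 197 < q\<close> by simp
    finally have "q * (q * q - 29028) \<le> 197 * 9781" .
    then show False using q3 by (simp add: power3_eq_cube algebra_simps)
  qed
  define s where "s = 256 - 324 * x + 444 * x ^ 2"
  \<comment> \<open>The second factor is the quotient of polynomial division by the cubic of
    \<open>x\<close>, which leaves no remainder.\<close>
  have "s ^ 3 - 29028 * s - 1997836 = (4 * x ^ 3 - 4 * x ^ 2 + 4 * x - 1)
      * (21882096 * x ^ 3 - 26021952 * x ^ 2 + 24903072 * x - 7348212)"
    unfolding s_def by algebra
  then have s3: "s ^ 3 - 29028 * s - 1997836 = 0" unfolding x by simp
  have "(s - q) * (s ^ 2 + s * q + q ^ 2 - 29028)
      = (s ^ 3 - 29028 * s - 1997836) - (q ^ 3 - 29028 * q - 1997836)"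
    by (simp add: power3_eq_cube power2_eq_square algebra_simps)
  also have "\<dots> = 0" using q3 s3 by simp
  finally have "s = q \<or> s ^ 2 + s * q + q ^ 2 - 29028 = 0" by simp
  moreover have "s ^ 2 + s * q + q ^ 2 - 29028 \<noteq> 0"
  proof -
    have "197 * 197 < q * q" using q197 by (intro mult_strict_mono) auto
    moreover have "0 \<le> (s + q / 2) ^ 2" by simp
    moreover have "s ^ 2 + s * q + q ^ 2 - 29028 = (s + q / 2) ^ 2 + (3 / 4) * (q * q) - 29028"
      by (simp add: power2_eq_square algebra_simps)
    ultimately show ?thesis by linarith
  qed
  ultimately have sq: "q = s" by simp
  \<comment> \<open>Both numbers are multiples of 12^3, so this radical is
    \<open>12 * a\<close>.\<close>
  have "(1726130304 - 69393024 * sqrt 57) powr (1 / 3) = (12 ^ 3 * (998918 - 40158 * sqrt 57)) powr (1 / 3)"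
    by (simp add: algebra_simps)
  also have "\<dots> = (12 ^ 3) powr (1 / 3) * a"
    unfolding a_def by (rule powr_mult)
  also have "(12 ^ 3 :: real) powr (1 / 3) = 12"
  proof -
    have "((12 ^ 3 :: real) powr (1 / 3)) ^ 3 = 12 ^ 3" by (rule cube_powr_third) simp
    then show ?thesis by (subst (asm) power_eq_iff_eq_base) auto
  qed
  finally have \<gamma>: "\<gamma> = 1 / (4 * sqrt 291) * sqrt (576 + 12 * q)"
    unfolding gamma q_def by (simp add: b_def)
  then show "0 < \<gamma>" using q0 by simp
  have "\<gamma> ^ 2 = (576 + 12 * q) / (16 * 291)"
    unfolding \<gamma> using q0 by (simp add: power_mult_distrib power_divide)
  then show "\<gamma> ^ 2 = (76 - 81 * x + 111 * x ^ 2) / 97"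
    unfolding sq s_def by (simp add: field_simps)
qed

lemma gamma_bounds:
  fixes x \<gamma> :: real
  assumes x: "0.319448 < x" "x < 0.3194485" and g: "0 < \<gamma>" "\<gamma> ^ 2 = (76 - 81 * x + 111 * x ^ 2) / 97"
  shows "\<bar>\<gamma> - 0.79594\<bar> \<le> 0.000005"
proof -
  have "0.319448 ^ 2 \<le> x ^ 2" "x ^ 2 \<le> 0.3194485 ^ 2" using x by (intro power_mono; simp)+
  then have "0.795935 ^ 2 \<le> \<gamma> ^ 2" "\<gamma> ^ 2 \<le> 0.795945 ^ 2"
    using x unfolding g(2) by (simp_all add: power2_eq_square)
  then have "0.795935 \<le> \<gamma>" "\<gamma> \<le> 0.795945"
    using g(1) by (auto intro: power2_le_imp_le)
  then show ?thesis unfolding abs_le_iff by simp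
qed


section \<open>Asymptotics\<close>

lemma fps_sqrt_one_plus_exists:
  fixes g :: "real fps"
  assumes "fps_nth g 0 = 0"
  obtains h where "(1 + h) ^ 2 = 1 + g" "fps_nth h 0 = 0"
proof -
  define s where "s = fps_sqrt (1 + g)"
  have s2: "s ^ 2 = 1 + g" using fps_sqrt_square[of "1 + g" 0] assms by (simp add: s_def)
  then have "fps_nth (s ^ 2) 0 = 1" using assms by simp
  then have "fps_nth s 0 ^ 2 = 1" by (simp add: fps_nth_power_0)
  then have "fps_nth s 0 = 1 \<or> fps_nth s 0 = - 1" by (simp add: power2_eq_1_iff)
  then show thesis
  proof
    assume "fps_nth s 0 = 1"
    then show thesis using that[of "s - 1"] s2 by simp
  next
    assume "fps_nth s 0 = - 1"
    then show thesis using that[of "- s - 1"] s2 by simp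
  qed
qed

text \<open>
  The generating function \<open>G\<close> of the accepted trees satisfies \<open>X (2 G - 1) = k - s / k\<close>, where \<open>s\<close>
  is the inner square root of the closed form. At the smallest zero \<open>x\<close> of \<open>s\<^sup>2\<close> only the factor
  \<open>sqrt (1 - X / x)\<close> of \<open>s\<close> is singular.
\<close>

lemma tree_gf_good_singular_form:
  fixes x c :: real
  assumes x: "4 * x ^ 3 - 4 * x ^ 2 + 4 * x - 1 = 0" and xc: "x * c = 1"
    and h1: "(1 + h1) ^ 2 = 1 + (fps_const 2 * fps_X + fps_const (1 / 4) * (fps_X * fps_X))" "fps_nth h1 0 = 0"
    and h2: "(1 + h2) ^ 2 = 1 + (fps_const (1 / 2) * (fps_X * fps_X) - fps_X + fps_X * h1)" "fps_nth h2 0 = 0"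
    and h3: "(1 + h3) ^ 2 = 1 + (fps_const (4 * x) * (fps_X * fps_X) - fps_const (4 - c) * fps_X)" "fps_nth h3 0 = 0"
    and j: "j * (1 + h2) = 1"
  shows "2 * fps_X * tree_gf good = fps_X + 1 + h2 - sqrt_linear c * ((1 + h3) * j)"
proof -
  define G where "G = tree_gf good"
  define s where "s = fps_sqrt (1 - 4 * fps_X + 4 * fps_X ^ 2 - 4 * fps_X ^ 3)"
  note cf = tree_gf_good_closed_form[folded G_def s_def]
  \<comment> \<open>The reciprocal polynomial, of which c = 1/x is a zero.\<close>
  have cubic: "c ^ 3 - 4 * c ^ 2 + 4 * c - 4 = 0"
  proof -
    have "c ^ 3 - 4 * c ^ 2 + 4 * c - 4
        = c ^ 3 - 4 * c ^ 2 * (x * c) + 4 * c * (x * c) ^ 2 - 4 * (x * c) ^ 3" unfolding xc by simp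
    also have "\<dots> = - (c ^ 3) * (4 * x ^ 3 - 4 * x ^ 2 + 4 * x - 1)"
      by (simp add: power3_eq_cube power2_eq_square algebra_simps)
    finally show ?thesis unfolding x by simp
  qed
  have sv: "s = sqrt_linear c * (1 + h3)"
    unfolding s_def
  proof (rule fps_sqrt_eqI)
    have "(sqrt_linear c * (1 + h3)) ^ 2 = (1 - fps_const c * fps_X)
        * (1 + (fps_const (4 * x) * (fps_X * fps_X) - fps_const (4 - c) * fps_X))"
      by (simp only: power_mult_distrib sqrt_linear_square h3)
    also have "\<dots> = 1 - fps_const (c + (4 - c)) * fps_X + fps_const (4 * x + c * (4 - c)) * fps_X ^ 2
        - fps_const (c * (4 * x)) * fps_X ^ 3"
      unfolding fps_const_add[symmetric] fps_const_mult[symmetric]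
      by (simp add: algebra_simps power2_eq_square power3_eq_cube)
    also have "c + (4 - c) = 4" by simp
    also have "4 * x + c * (4 - c) = 4"
    proof -
      have "c * (4 * x + c * (4 - c) - 4) = 4 * (x * c) - (c ^ 3 - 4 * c ^ 2 + 4 * c)"
        by (simp add: algebra_simps power2_eq_square power3_eq_cube)
      also have "\<dots> = 0" using cubic xc by simp
      finally show ?thesis using xc by auto
    qed
    also have "c * (4 * x) = 4" using xc by (simp add: mult_ac)
    finally show "(sqrt_linear c * (1 + h3)) ^ 2 = 1 - 4 * fps_X + 4 * fps_X ^ 2 - 4 * fps_X ^ 3"
      by (simp add: numeral_fps_const)
    show "0 < fps_nth (sqrt_linear c * (1 + h3)) 0" using h3 by (simp add: sqrt_linear_def)
  qed
  define cH where "cH = fps_const (1 / 2 :: real)"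
  have cH: "2 * cH = 1" "fps_const (1 / 4 :: real) = cH ^ 2" "fps_const (2 :: real) = 2"
    by (simp_all add: cH_def numeral_fps_const power2_eq_square)
  define a where "a = 1 - 2 * fps_X + cH * fps_X ^ 2"
  define k where "k = 1 + h2"
  have k2: "k ^ 2 = a + fps_X * (1 + h1)"
    unfolding k_def h2 a_def cH_def by (simp add: algebra_simps power2_eq_square)
  have m2: "(1 + h1) ^ 2 = 1 + 2 * fps_X + cH ^ 2 * fps_X ^ 2"
    unfolding h1 cH by (simp add: power2_eq_square)
  have a2: "a ^ 2 = 1 - 4 * fps_X + 4 * fps_X ^ 2 + (2 * cH) * fps_X ^ 2 - (2 * cH) * (2 * fps_X ^ 3) + cH ^ 2 * fps_X ^ 4"
    unfolding a_def by (simp add: algebra_simps power2_eq_square power3_eq_cube power4_eq_xxxx)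
  \<comment> \<open>\<open>a - fps_X * (1 + h1)\<close> is the conjugate of \<open>k ^ 2\<close>:
    their sum is \<open>2 * a\<close> and their product \<open>s ^ 2\<close>.\<close>
  have "(a - fps_X * (1 + h1)) * k ^ 2 = a ^ 2 - fps_X ^ 2 * (1 + h1) ^ 2"
    unfolding k2 by (simp add: algebra_simps power2_eq_square)
  also have "\<dots> = s ^ 2"
    unfolding a2 m2 cH(1) cf(1) by (simp add: algebra_simps power2_eq_square power3_eq_cube power4_eq_xxxx)
  finally have s2: "s ^ 2 = (a - fps_X * (1 + h1)) * k ^ 2" ..
  have jk: "j * k = 1" using j by (simp add: k_def)
  have "(k - s * j) ^ 2 = k ^ 2 - 2 * s * (j * k) + s ^ 2 * j ^ 2"
    by (simp add: algebra_simps power2_eq_square)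
  also have "\<dots> = k ^ 2 - 2 * s * (j * k) + (a - fps_X * (1 + h1)) * (j * k) ^ 2"
    unfolding s2 by (simp add: algebra_simps power_mult_distrib)
  also have "\<dots> = 2 * a - 2 * s" unfolding jk k2 by simp
  also have "2 * a = 2 - 4 * fps_X + (2 * cH) * fps_X ^ 2"
    unfolding a_def by (simp add: algebra_simps)
  also have "2 - 4 * fps_X + (2 * cH) * fps_X ^ 2 - 2 * s = (fps_X * (2 * G - 1)) ^ 2"
    unfolding cH(1) cf(3) by simp
  finally have "k - s * j = fps_X * (2 * G - 1) \<or> k - s * j = - (fps_X * (2 * G - 1))"
    by (simp only: power2_eq_iff)
  \<comment> \<open>The sign is decided by the coefficient of X, the lowest one present.\<close>
  moreover have "fps_nth (fps_X * (2 * G - 1)) 1 = 1"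
    using cf(5) by (simp add: numeral_fps_const)
  moreover have "fps_nth (k - s * j) 1 = 1"
  proof -
    have k1: "fps_nth k 1 = - 1 / 2"
    proof -
      have "fps_nth (k ^ 2) 1 = - 1"
        unfolding k_def h2(1) using h1(2) by (simp add: fps_mult_nth_1)
      then show ?thesis using h2(2) by (simp add: power2_eq_square fps_mult_nth_1 k_def)
    qed
    have s1: "fps_nth s 1 = - 2"
    proof -
      have "fps_nth (s ^ 2) 1 = - 4"
        unfolding cf(1) by (simp add: numeral_fps_const fps_X_power_nth)
      then show ?thesis using cf(2) by (simp add: power2_eq_square fps_mult_nth_1)
    qed
    have "fps_nth (j * k) 0 = 1" "fps_nth (j * k) 1 = 0" unfolding jk by simp_all
    then have "fps_nth j 0 = 1" "fps_nth j 1 = 1 / 2"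
      using k1 h2(2) by (simp_all add: fps_mult_nth_1 k_def)
    then show ?thesis using k1 s1 cf(2) by (simp add: fps_mult_nth_1)
  qed
  ultimately have "k - s * j = fps_X * (2 * G - 1)"
    by (metis fps_neg_nth one_neq_neg_one)
  then show ?thesis unfolding sv k_def G_def by (simp add: algebra_simps)
qed

lemma card_Eeta_wins_limit:
  fixes x c \<gamma> :: real
  assumes x: "4 * x ^ 3 - 4 * x ^ 2 + 4 * x - 1 = 0" and c: "c = 1 / x"
    and g: "0 < \<gamma>" "\<gamma> ^ 2 = (76 - 81 * x + 111 * x ^ 2) / 97"
  shows "(\<lambda>n. 2 * real (card (Eeta_wins (order_ideals (A_root_poset n)))) * (real n + 3) powr (3 / 2) / c ^ (n + 2))
    \<longlonglongrightarrow> 2 * x * \<gamma> / sqrt pi"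
proof -
  have xb: "0.319448 < x" "x < 0.3194485" using inverse_rho_bounds[OF x] by auto
  have x0: "0 < x" using xb by simp
  have xc: "x * c = 1" using x0 c by simp
  have cb: "3.13 < c" "c < 3.1305" using xb x0 unfolding c by (simp_all add: field_simps)
  \<comment> \<open>The radius must exceed x = 0.3194... and still leave each bound a for
    \<open>norm_bound_sqrt\<close> below 1. The numbers 0.441, 0.315 and 0.25 used as
    \<open>y\<close> lie just above the smaller root 1 - sqrt (1 - a) of y^2 - 2 y + a.\<close>
  define r where "r = (0.33 :: real)"
  have r0: "0 \<le> r" by (simp add: r_def)
  have xr: "\<bar>x\<bar> \<le> r" using xb x0 by (simp add: r_def)
  have bX: "norm_bound r fps_X r" by (rule norm_bound_X[OF r0])
  have bXX: "norm_bound r (fps_X * fps_X) (r * r)" by (rule norm_bound_mult[OF r0 bX bX])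
  have z1: "fps_nth (fps_const 2 * fps_X + fps_const (1 / 4) * (fps_X * fps_X)) 0 = (0 :: real)" by simp
  obtain h1 :: "real fps" where h1: "(1 + h1) ^ 2 = 1 + (fps_const 2 * fps_X + fps_const (1 / 4) * (fps_X * fps_X))" "fps_nth h1 0 = 0"
    by (rule fps_sqrt_one_plus_exists[OF z1])
  have z2: "fps_nth (fps_const (1 / 2) * (fps_X * fps_X) - fps_X + fps_X * h1) 0 = (0 :: real)" by simp
  obtain h2 :: "real fps" where h2: "(1 + h2) ^ 2 = 1 + (fps_const (1 / 2) * (fps_X * fps_X) - fps_X + fps_X * h1)" "fps_nth h2 0 = 0"
    by (rule fps_sqrt_one_plus_exists[OF z2])
  have z3: "fps_nth (fps_const (4 * x) * (fps_X * fps_X) - fps_const (4 - c) * fps_X) 0 = (0 :: real)" by simp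
  obtain h3 :: "real fps" where h3: "(1 + h3) ^ 2 = 1 + (fps_const (4 * x) * (fps_X * fps_X) - fps_const (4 - c) * fps_X)" "fps_nth h3 0 = 0"
    by (rule fps_sqrt_one_plus_exists[OF z3])
  define j where "j = inverse (1 + h2)"
  have j: "j * (1 + h2) = 1" unfolding j_def using h2(2) by (intro inverse_mult_eq_1) simp
  have g1: "norm_bound r (fps_const 2 * fps_X + fps_const (1 / 4) * (fps_X * fps_X)) (\<bar>2\<bar> * r + \<bar>1 / 4\<bar> * (r * r))"
    by (intro norm_bound_add norm_bound_mult norm_bound_const bX bXX r0)
  have b1: "norm_bound r h1 0.441"
    by (rule norm_bound_sqrt[OF r0 g1 h1]) (simp_all add: r_def power2_eq_square)
  have g2: "norm_bound r (fps_const (1 / 2) * (fps_X * fps_X) - fps_X + fps_X * h1) (\<bar>1 / 2\<bar> * (r * r) + r + r * 0.441)"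
    by (intro norm_bound_add norm_bound_diff norm_bound_mult norm_bound_const bX b1 r0)
  have b2: "norm_bound r h2 0.315"
    by (rule norm_bound_sqrt[OF r0 g2 h2]) (simp_all add: r_def power2_eq_square)
  have g3: "norm_bound r (fps_const (4 * x) * (fps_X * fps_X) - fps_const (4 - c) * fps_X) (\<bar>4 * x\<bar> * (r * r) + \<bar>4 - c\<bar> * r)"
    by (intro norm_bound_diff norm_bound_mult norm_bound_const bX r0)
  have "\<bar>4 * x\<bar> \<le> 1.278" "\<bar>4 - c\<bar> \<le> 0.87" using xb cb by simp_all
  then have "\<bar>4 * x\<bar> * (r * r) + \<bar>4 - c\<bar> * r \<le> 1.278 * (r * r) + 0.87 * r"
    using r0 by (intro add_mono mult_right_mono) auto
  also have "\<dots> \<le> 0.43" by (simp add: r_def)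
  finally have "\<bar>4 * x\<bar> * (r * r) + \<bar>4 - c\<bar> * r \<le> 0.43" .
  from norm_bound_sqrt[OF r0 norm_bound_mono[OF g3 this] h3, of "0.25"]
  have b3: "norm_bound r h3 0.25" by (simp add: power2_eq_square)
  have b1c: "norm_bound r 1 1" using norm_bound_const[of r 1] by simp
  have bj: "norm_bound r j (1 / (1 - 0.315))" by (rule norm_bound_inverse[OF r0 b2 _ j]) simp
  have bv: "norm_bound r (1 + h3) (1 + 0.25)" by (rule norm_bound_add[OF r0 b1c b3])
  have bk: "norm_bound r (1 + h2) (1 + 0.315)" by (rule norm_bound_add[OF r0 b1c b2])
  have bm: "norm_bound r (1 + h1) (1 + 0.441)" by (rule norm_bound_add[OF r0 b1c b1])
  define u where "u = (1 + h3) * j"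
  have bu: "norm_bound r u ((1 + 0.25) * (1 / (1 - 0.315)))"
    unfolding u_def by (rule norm_bound_mult[OF r0 bv bj])
  have one: "fps_value 1 x = 1" using fps_value_const[of 1 x] by simp
  define V where "V = fps_value (1 + h3) x"
  define K where "K = fps_value (1 + h2) x"
  define M where "M = fps_value (1 + h1) x"
  have VK: "V = 1 + fps_value h3 x" "K = 1 + fps_value h2 x" "M = 1 + fps_value h1 x"
    unfolding V_def K_def M_def
    using fps_value_add[OF r0 b1c b3 xr] fps_value_add[OF r0 b1c b2 xr] fps_value_add[OF r0 b1c b1 xr] one
    by simp_all
  have pos: "0 < V" "0 < K" "0 < M"
    unfolding VK using abs_fps_value_le[OF r0 b3 xr] abs_fps_value_le[OF r0 b2 xr] abs_fps_value_le[OF r0 b1 xr]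
    by (simp_all add: abs_le_iff)
  have vX: "fps_value fps_X x = x" by (rule fps_value_X)
  have vXX: "fps_value (fps_X * fps_X) x = x * x" using fps_value_mult[OF r0 bX bX xr] vX by simp
  have diffv: "fps_value (f - h) x = fps_value f x - fps_value h x"
    if "norm_bound r f a" "norm_bound r h b" for f h a b
  proof -
    have "fps_value (fps_const (- 1) * h) x = - fps_value h x"
      using fps_value_mult[OF r0 norm_bound_const that(2) xr, of "- 1"] by (simp add: fps_value_const)
    then have "fps_value (f + fps_const (- 1) * h) x = fps_value f x - fps_value h x"
      using fps_value_add[OF r0 that(1) norm_bound_mult[OF r0 norm_bound_const that(2)] xr, of "- 1"] by simp
    moreover have "f + fps_const (- 1) * h = f - h" by (rule fps_ext) simp
    ultimately show ?thesis by (simp only:)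
  qed
  have cmul: "fps_value (fps_const e * f) x = e * fps_value f x" if "norm_bound r f a" for e f a
    using fps_value_mult[OF r0 norm_bound_const that xr, of e] by (simp add: fps_value_const)
  have V2: "V ^ 2 = 1 + (4 * x * (x * x) - (4 - c) * x)"
  proof -
    have "V ^ 2 = fps_value ((1 + h3) ^ 2) x"
      unfolding V_def power2_eq_square using fps_value_mult[OF r0 bv bv xr] by simp
    also have "\<dots> = 1 + fps_value (fps_const (4 * x) * (fps_X * fps_X) - fps_const (4 - c) * fps_X) x"
      unfolding h3(1) using fps_value_add[OF r0 b1c g3 xr] one by simp
    also have "fps_value (fps_const (4 * x) * (fps_X * fps_X) - fps_const (4 - c) * fps_X) x
        = 4 * x * (x * x) - (4 - c) * x"
      by (subst diffv[OF norm_bound_mult[OF r0 norm_bound_const bXX] norm_bound_mult[OF r0 norm_bound_const bX]])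
        (simp only: cmul[OF bXX] cmul[OF bX] vX vXX)
    finally show ?thesis .
  qed
  have M2: "M ^ 2 = 1 + (2 * x + 1 / 4 * (x * x))"
  proof -
    have "M ^ 2 = fps_value ((1 + h1) ^ 2) x"
      unfolding M_def power2_eq_square using fps_value_mult[OF r0 bm bm xr] by simp
    also have "\<dots> = 1 + fps_value (fps_const 2 * fps_X + fps_const (1 / 4) * (fps_X * fps_X)) x"
      unfolding h1(1) using fps_value_add[OF r0 b1c g1 xr] one by simp
    also have "fps_value (fps_const 2 * fps_X + fps_const (1 / 4) * (fps_X * fps_X)) x = 2 * x + 1 / 4 * (x * x)"
      by (subst fps_value_add[OF r0 norm_bound_mult[OF r0 norm_bound_const bX] norm_bound_mult[OF r0 norm_bound_const bXX] xr])
        (simp only: cmul[OF bXX] cmul[OF bX] vX vXX)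
    finally show ?thesis .
  qed
  have K2: "K ^ 2 = 1 + (1 / 2 * (x * x) - x + x * (M - 1))"
  proof -
    have "K ^ 2 = fps_value ((1 + h2) ^ 2) x"
      unfolding K_def power2_eq_square using fps_value_mult[OF r0 bk bk xr] by simp
    also have "\<dots> = 1 + fps_value (fps_const (1 / 2) * (fps_X * fps_X) - fps_X + fps_X * h1) x"
      unfolding h2(1) using fps_value_add[OF r0 b1c g2 xr] one by simp
    also have "fps_value (fps_const (1 / 2) * (fps_X * fps_X) - fps_X + fps_X * h1) x
        = fps_value (fps_const (1 / 2) * (fps_X * fps_X) - fps_X) x + fps_value (fps_X * h1) x"
      by (rule fps_value_add[OF r0 norm_bound_diff[OF r0 norm_bound_mult[OF r0 norm_bound_const bXX] bX] norm_bound_mult[OF r0 bX b1] xr])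
    also have "fps_value (fps_X * h1) x = x * (M - 1)"
      using fps_value_mult[OF r0 bX b1 xr] vX VK by simp
    also have "fps_value (fps_const (1 / 2) * (fps_X * fps_X) - fps_X) x = 1 / 2 * (x * x) - x"
      by (subst diffv[OF norm_bound_mult[OF r0 norm_bound_const bXX] bX]) (simp only: cmul[OF bXX] vX vXX)
    finally show ?thesis .
  qed
  \<comment> \<open>The inner root vanishes at \<open>x\<close>, hence so does the conjugate of
    \<open>k ^ 2\<close>; positivity of both sides excludes the other sign.\<close>
  have xM: "x * M = 1 - 2 * x + x ^ 2 / 2"
  proof -
    have "(x * M) ^ 2 = x ^ 2 * (1 + (2 * x + 1 / 4 * (x * x)))" by (simp add: power_mult_distrib M2)
    also have "\<dots> = (1 - 2 * x + x ^ 2 / 2) ^ 2 + (4 * x ^ 3 - 4 * x ^ 2 + 4 * x - 1)"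
      by (simp add: power2_eq_square power3_eq_cube algebra_simps)
    finally have "(x * M) ^ 2 = (1 - 2 * x + x ^ 2 / 2) ^ 2" unfolding x by simp
    moreover have "0 \<le> 1 - 2 * x + x ^ 2 / 2" using xb by (intro add_nonneg_nonneg) auto
    moreover have "0 \<le> x * M" using x0 pos by simp
    ultimately show ?thesis by (simp add: power2_eq_iff_nonneg)
  qed
  have K2': "K ^ 2 = x ^ 2 - 4 * x + 2"
    unfolding K2 right_diff_distrib xM by (simp add: power2_eq_square algebra_simps)
  have V2': "V ^ 2 = 3 - 8 * x + 4 * x ^ 2"
  proof -
    have "V ^ 2 = 1 + 4 * x ^ 3 - 4 * x + x * c"
      unfolding V2 by (simp add: power3_eq_cube algebra_simps)
    then show ?thesis unfolding xc using x by linarith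
  qed
  \<comment> \<open>This is where gamma comes from: V^2 / (16 x^2 K^2), reduced modulo the cubic of
    \<open>x\<close>, is the quadratic polynomial given for its square. The long factor below is
    again a quotient by the cubic.\<close>
  have "(4 * x * \<gamma> * K) ^ 2 = 16 * x ^ 2 * ((76 - 81 * x + 111 * x ^ 2) / 97) * (x ^ 2 - 4 * x + 2)"
    unfolding power_mult_distrib K2' g(2) by simp
  also have "\<dots> = 3 - 8 * x + 4 * x ^ 2 + (4 * x ^ 3 - 4 * x ^ 2 + 4 * x - 1)
      * (3 + 4 * x - 1656 / 97 * x ^ 2 + 444 / 97 * x ^ 3)"
    by algebra
  also have "\<dots> = V ^ 2" unfolding x V2' by simp
  finally have VgK: "V = 4 * x * \<gamma> * K"
    using pos x0 g by (simp add: power2_eq_iff_nonneg)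
  have uval: "fps_value u x = 4 * x * \<gamma>"
  proof -
    have "fps_value j x * K = 1"
      unfolding K_def using fps_value_mult[OF r0 bj bk xr] j one by simp
    moreover have "fps_value u x = V * fps_value j x"
      unfolding u_def V_def by (rule fps_value_mult[OF r0 bv bj xr])
    ultimately show ?thesis unfolding VgK by (simp add: mult.assoc mult.commute)
  qed
  have "1 / c < r" using xb xc c x0 by (simp add: r_def)
  from sqrt_linear_mult_asymptotics[OF _ this bu] cb
  have lim1: "(\<lambda>N. fps_nth (sqrt_linear c * u) N * (real N + 1) powr (3 / 2) / c ^ N)
      \<longlonglongrightarrow> - 1 / (2 * sqrt pi) * fps_value u (1 / c)" by simp
  have lim2: "(\<lambda>N. fps_nth h2 N * (real N + 1) powr (3 / 2) / c ^ N) \<longlonglongrightarrow> 0"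
  proof (rule Lim_null_comparison)
    define q where "q = 1 / (r * c)"
    have "1 < r * c" using cb by (simp add: r_def)
    then have q: "0 < q" "q < 1" by (simp_all add: q_def)
    show "(\<lambda>N. 0.315 * (real N + 1) powr (3 / 2) * q ^ N) \<longlonglongrightarrow> 0" using q by real_asymp
    show "eventually (\<lambda>N. norm (fps_nth h2 N * (real N + 1) powr (3 / 2) / c ^ N)
        \<le> 0.315 * (real N + 1) powr (3 / 2) * q ^ N) sequentially"
    proof (intro always_eventually allI)
      fix N
      have rN: "0 < r ^ N" by (simp add: r_def)
      have cN: "0 < c ^ N" using cb by simp
      have "\<bar>fps_nth h2 N\<bar> * r ^ N \<le> 0.315" by (rule norm_bound_nth[OF r0 b2])
      then have "\<bar>fps_nth h2 N\<bar> \<le> 0.315 / r ^ N" using rN by (simp add: pos_le_divide_eq)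
      then have "\<bar>fps_nth h2 N\<bar> * ((real N + 1) powr (3 / 2) / c ^ N)
          \<le> 0.315 / r ^ N * ((real N + 1) powr (3 / 2) / c ^ N)"
        using cN by (intro mult_right_mono) auto
      also have "\<dots> = 0.315 * (real N + 1) powr (3 / 2) * q ^ N"
        by (simp add: q_def power_divide power_mult_distrib)
      finally show "norm (fps_nth h2 N * (real N + 1) powr (3 / 2) / c ^ N)
          \<le> 0.315 * (real N + 1) powr (3 / 2) * q ^ N"
        using cN by (simp add: abs_mult)
    qed
  qed
  have lim: "(\<lambda>N. (fps_nth h2 N - fps_nth (sqrt_linear c * u) N) * (real N + 1) powr (3 / 2) / c ^ N)
      \<longlonglongrightarrow> 2 * x * \<gamma> / sqrt pi"
  proof -
    have "1 / c = x" using c by simp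
    then have e: "0 - (- 1 / (2 * sqrt pi) * fps_value u (1 / c)) = 2 * x * \<gamma> / sqrt pi"
      by (simp add: uval)
    show ?thesis using tendsto_diff[OF lim2 lim1] unfolding e
      by (simp add: left_diff_distrib diff_divide_distrib)
  qed
  \<comment> \<open>Index \<open>n + 2\<close> combines the \<open>n + 1\<close> nodes with the
    factor X, and is large enough for the terms \<open>fps_X + 1\<close> to drop out.\<close>
  have coeff: "2 * real (card (Eeta_wins (order_ideals (A_root_poset n))))
      = fps_nth h2 (n + 2) - fps_nth (sqrt_linear c * u) (n + 2)" for n
  proof -
    have "2 * real (card (Eeta_wins (order_ideals (A_root_poset n))))
        = fps_nth (2 * fps_X * tree_gf good) (n + 2)"
      by (simp add: card_Eeta_wins_eq_tree_gf numeral_fps_const mult.assoc)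
    also have "2 * fps_X * tree_gf good = fps_X + 1 + h2 - sqrt_linear c * u"
      unfolding u_def by (rule tree_gf_good_singular_form[OF x xc h1 h2 h3 j])
    finally show ?thesis by (simp add: fps_X_nth)
  qed
  have "(\<lambda>n. (fps_nth h2 (n + 2) - fps_nth (sqrt_linear c * u) (n + 2)) * (real (n + 2) + 1) powr (3 / 2) / c ^ (n + 2))
      \<longlonglongrightarrow> 2 * x * \<gamma> / sqrt pi"
    using LIMSEQ_ignore_initial_segment[OF lim, of 2] .
  then show ?thesis unfolding coeff[symmetric] by (simp add: add.commute)
qed

lemma card_Eeta_wins_asymp:
  fixes x c \<gamma> :: real
  assumes x: "4 * x ^ 3 - 4 * x ^ 2 + 4 * x - 1 = 0" and c: "c = 1 / x"
    and g: "0 < \<gamma>" "\<gamma> ^ 2 = (76 - 81 * x + 111 * x ^ 2) / 97"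
  shows "(\<lambda>n. real (card (Eeta_wins (order_ideals (A_root_poset n)))))
      \<sim>[at_top] (\<lambda>n. \<gamma> / sqrt pi * real n powr (- 3 / 2) * c ^ (n + 1))"
proof (rule asymp_equivI')
  let ?e = "\<lambda>n. real (card (Eeta_wins (order_ideals (A_root_poset n))))"
  have x0: "0 < x" using inverse_rho_bounds[OF x] by simp
  have c0: "0 < c" using c x0 by simp
  \<comment> \<open>The added factor trades (n + 3)^(3/2) for n^(3/2) and one power of c; its limit
    is the reciprocal of the previous one because x c = 1.\<close>
  have "(\<lambda>n. (2 * ?e n * (real n + 3) powr (3 / 2) / c ^ (n + 2)) * ((real n / (real n + 3)) powr (3 / 2) * (c * sqrt pi / (2 * \<gamma>))))
      \<longlonglongrightarrow> (2 * x * \<gamma> / sqrt pi) * (1 * (c * sqrt pi / (2 * \<gamma>)))"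
  proof (intro tendsto_mult tendsto_const card_Eeta_wins_limit[OF assms])
    show "(\<lambda>n. (real n / (real n + 3)) powr (3 / 2)) \<longlonglongrightarrow> 1" by real_asymp
  qed
  also have "(2 * x * \<gamma> / sqrt pi) * (1 * (c * sqrt pi / (2 * \<gamma>))) = 1"
    using c x0 g by simp
  finally have lim: "(\<lambda>n. (2 * ?e n * (real n + 3) powr (3 / 2) / c ^ (n + 2)) * ((real n / (real n + 3)) powr (3 / 2) * (c * sqrt pi / (2 * \<gamma>))))
      \<longlonglongrightarrow> 1" .
  have ev: "eventually (\<lambda>n. (2 * ?e n * (real n + 3) powr (3 / 2) / c ^ (n + 2)) * ((real n / (real n + 3)) powr (3 / 2) * (c * sqrt pi / (2 * \<gamma>)))
      = ?e n / (\<gamma> / sqrt pi * real n powr (- 3 / 2) * c ^ (n + 1))) sequentially"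
    using eventually_gt_at_top[of 0]
  proof eventually_elim
    case (elim n)
    define P where "P = real n powr (3 / 2)"
    define R where "R = (real n + 3) powr (3 / 2)"
    have PR: "0 < P" "0 < R" using elim by (auto simp: P_def R_def)
    have p: "(real n / (real n + 3)) powr (3 / 2) = P / R" by (simp add: P_def R_def powr_divide)
    have m: "real n powr (- 3 / 2) = 1 / P"
      using powr_minus_divide[of "real n" "3 / 2"] by (simp add: P_def)
    define e where "e = ?e n"
    define d where "d = c ^ n"
    have d: "0 < d" "c ^ (n + 2) = c * (c * d)" "c ^ (n + 1) = c * d" using c0 by (simp_all add: d_def)
    have "2 * e * R / (c * (c * d)) * (P / R * (c * sqrt pi / (2 * \<gamma>))) = e / (\<gamma> / sqrt pi * (1 / P) * (c * d))"
      using PR d(1) c0 g(1) by (simp add: field_simps)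
    then show ?case unfolding p m d R_def[symmetric] e_def .
  qed
  show "((\<lambda>n. ?e n / (\<gamma> / sqrt pi * real n powr (- 3 / 2) * c ^ (n + 1))) \<longlongrightarrow> 1) at_top"
    by (rule Lim_transform_eventually[OF lim ev])
qed

theorem theorem1p9:
  fixes \<rho> \<gamma> :: real
  assumes rho: "\<rho> = 6 / (2 - 8 * (3 * sqrt 57 - 1) powr (- 1 / 3) + (3 * sqrt 57 - 1) powr (1 / 3))"
    and gamma: "\<gamma> = 1 / (4 * sqrt 291) *
      sqrt (576 + (1726130304 - 69393024 * sqrt 57) powr (1 / 3)
                + 12 * (998918 + 40158 * sqrt 57) powr (1 / 3))"
  shows "(Abs_fps (\<lambda>n. if n \<ge> 1 then real (card (Eeta_wins (order_ideals (A_root_poset n)))) else 0)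
      = (- 1 - 2 * fps_X
         + fps_sqrt (fps_X ^ 2 - 4 * fps_X + 2
             - 2 * fps_sqrt (1 - 4 * fps_X + 4 * fps_X ^ 2 - 4 * fps_X ^ 3)) / fps_X)
        / (2 * fps_X))
    \<and> ((\<lambda>n. real (card (Eeta_wins (order_ideals (A_root_poset n)))))
      \<sim>[at_top] (\<lambda>n. \<gamma> / sqrt pi * real n powr (- 3 / 2) * \<rho> ^ (n + 1)))
    \<and> \<bar>\<rho> - 3.13040\<bar> \<le> 0.000005
    \<and> \<bar>\<gamma> - 0.79594\<bar> \<le> 0.000005"
proof (intro conjI)
  define x where "x = (2 - 8 * (3 * sqrt 57 - 1) powr (- 1 / 3) + (3 * sqrt 57 - 1) powr (1 / 3)) / 6"
  have x: "4 * x ^ 3 - 4 * x ^ 2 + 4 * x - 1 = 0" by (rule inverse_rho_cubic[OF x_def])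
  have xb: "0.319448 < x" "x < 0.3194485" using inverse_rho_bounds[OF x] by auto
  have \<rho>: "\<rho> = 1 / x" unfolding rho x_def by simp
  note g = gamma_square[OF x gamma]
  show "Abs_fps (\<lambda>n. if n \<ge> 1 then real (card (Eeta_wins (order_ideals (A_root_poset n)))) else 0)
      = (- 1 - 2 * fps_X
         + fps_sqrt (fps_X ^ 2 - 4 * fps_X + 2
             - 2 * fps_sqrt (1 - 4 * fps_X + 4 * fps_X ^ 2 - 4 * fps_X ^ 3)) / fps_X)
        / (2 * fps_X)"
    by (rule Eeta_wins_gf)
  show "(\<lambda>n. real (card (Eeta_wins (order_ideals (A_root_poset n)))))
      \<sim>[at_top] (\<lambda>n. \<gamma> / sqrt pi * real n powr (- 3 / 2) * \<rho> ^ (n + 1))"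
    by (rule card_Eeta_wins_asymp[OF x \<rho> g])
  have "3.130395 < \<rho>" "\<rho> < 3.130405"
    using xb unfolding \<rho> by (simp_all add: field_simps)
  then show "\<bar>\<rho> - 3.13040\<bar> \<le> 0.000005" unfolding abs_le_iff by simp
  show "\<bar>\<gamma> - 0.79594\<bar> \<le> 0.000005" by (rule gamma_bounds[OF xb g])
qed

end
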